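(* Let $T$ be a bounded operator on $\mathcal{H}$. For $0\le t\le 1$, there exists $s_t\ge 0$ such that $r(T)\le s_t\le\|T\|$ and $\lim_{n\to\infty}\|\Delta_t^{(n)}(T)\|=s_t$.
   Context: $\mathcal{H}$ is a complex infinite-dimensional Hilbert space. For a bounded operator $T$ on $\mathcal{H}$ with canonical polar decomposition $T=V|T|$ ($|T|=\sqrt{T^*T}$, $V$ a partial isometry with $\ker V=\ker T$) and $0\le t\le 1$, the generalized Aluthge transform is $\Delta_t(T):=|T|^tV|T|^{1-t}$, with the convention $|T|^0=I$. $\Delta_t^{(n)}$ denotes the $n$-th iterate of $\Delta_t$, and $r(T)$ is the spectral radius of $T$. *)

theory Defs
  imports "HOL-Analysis.Analysis" "HOL-Computational_Algebra.Polynomial"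
begin

text \<open>
  Complex Hilbert spaces. The inner product is linear in its first argument. Completeness and the
  underlying real normed structure come from \<open>banach\<close>; the last axiom makes its norm the one
  induced by the inner product.
\<close>

class complex_hilbert_space = banach +
  fixes scaleC :: "complex \<Rightarrow> 'a \<Rightarrow> 'a"  (infixr \<open>*\<^sub>C\<close> 75)
    and cinner :: "'a \<Rightarrow> 'a \<Rightarrow> complex"
  assumes scaleC_add_right: "a *\<^sub>C (x + y) = a *\<^sub>C x + a *\<^sub>C y"
    and scaleC_add_left: "(a + b) *\<^sub>C x = a *\<^sub>C x + b *\<^sub>C x"
    and scaleC_scaleC: "a *\<^sub>C b *\<^sub>C x = (a * b) *\<^sub>C x"
    and scaleC_one: "1 *\<^sub>C x = x"
    and scaleR_scaleC: "r *\<^sub>R x = complex_of_real r *\<^sub>C x"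
    and cinner_commute: "cinner x y = cnj (cinner y x)"
    and cinner_add_left: "cinner (x + y) z = cinner x z + cinner y z"
    and cinner_scaleC_left: "cinner (a *\<^sub>C x) y = a * cinner x y"
    and norm_eq_sqrt_cinner: "norm x = sqrt (Re (cinner x x))"

global_interpretation complex_vector:
  vector_space "scaleC :: complex \<Rightarrow> 'a \<Rightarrow> 'a::complex_hilbert_space"
  by unfold_locales (simp_all add: scaleC_add_right scaleC_add_left scaleC_scaleC scaleC_one)

text \<open>
  Bounded operators are elements of the library type of bounded real-linear maps (whose norm is the
  operator norm) that are moreover complex-linear.
\<close>

definition clinear_op :: "('a::complex_hilbert_space \<Rightarrow>\<^sub>L 'a) \<Rightarrow> bool" where
  "clinear_op T \<longleftrightarrow> Vector_Spaces.linear scaleC scaleC (blinfun_apply T)"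

definition adjoint_op ::
    "('a::complex_hilbert_space \<Rightarrow>\<^sub>L 'a) \<Rightarrow> ('a \<Rightarrow>\<^sub>L 'a)" where
  "adjoint_op T = (THE S :: 'a \<Rightarrow>\<^sub>L 'a. \<forall>x y. cinner (T x) y = cinner x (S y))"

text \<open>The spectrum: all \<open>z\<close> for which \<open>T - z I\<close> has no bounded inverse.\<close>

definition op_spectrum :: "('a::complex_hilbert_space \<Rightarrow>\<^sub>L 'a) \<Rightarrow> complex set" where
  "op_spectrum T = {z. \<not> (\<exists>S :: 'a \<Rightarrow>\<^sub>L 'a. clinear_op S \<and>
     (\<forall>x. S (T x - z *\<^sub>C x) = x) \<and> (\<forall>x. T (S x) - z *\<^sub>C S x = x))}"

definition op_spectral_radius :: "('a::complex_hilbert_space \<Rightarrow>\<^sub>L 'a) \<Rightarrow> real" where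
  "op_spectral_radius T = (SUP z\<in>op_spectrum T. cmod z)"

primrec op_power ::
    "('a::complex_hilbert_space \<Rightarrow>\<^sub>L 'a) \<Rightarrow> nat \<Rightarrow> ('a \<Rightarrow>\<^sub>L 'a)" where
  "op_power A 0 = id_blinfun"
| "op_power A (Suc n) = A o\<^sub>L op_power A n"

definition op_poly ::
    "real poly \<Rightarrow> ('a::complex_hilbert_space \<Rightarrow>\<^sub>L 'a) \<Rightarrow> ('a \<Rightarrow>\<^sub>L 'a)" where
  "op_poly p A = (\<Sum>i\<le>degree p. coeff p i *\<^sub>R op_power A i)"

text \<open>
  Continuous functional calculus of a self-adjoint operator \<open>A\<close> (whose spectrum is real) at a
  real-valued \<open>f\<close> continuous on the spectrum: \<open>f(A)\<close> is the common norm limit of \<open>p\<^sub>n(A)\<close>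
  over all sequences of polynomials \<open>p\<^sub>n\<close> converging to \<open>f\<close> uniformly on the spectrum.
  Only such \<open>A\<close> and \<open>f\<close> are meaningful arguments.
\<close>

definition cont_calculus ::
    "(real \<Rightarrow> real) \<Rightarrow> ('a::complex_hilbert_space \<Rightarrow>\<^sub>L 'a) \<Rightarrow> ('a \<Rightarrow>\<^sub>L 'a)" where
  "cont_calculus f A = (THE B. \<forall>p :: nat \<Rightarrow> real poly.
     uniform_limit {x. complex_of_real x \<in> op_spectrum A} (\<lambda>n. poly (p n)) f sequentially
       \<longrightarrow> (\<lambda>n. op_poly (p n) A) \<longlonglongrightarrow> B)"

definition abs_op :: "('a::complex_hilbert_space \<Rightarrow>\<^sub>L 'a) \<Rightarrow> ('a \<Rightarrow>\<^sub>L 'a)" where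
  "abs_op T = cont_calculus sqrt (adjoint_op T o\<^sub>L T)"

text \<open>
  Powers of a positive operator with exponent \<open>t \<ge> 0\<close>. The case \<open>t = 0\<close> is separate because
  \<open>0 powr 0 = 0\<close>, whereas the zeroth power of every operator is to be the identity.
\<close>

definition op_powr ::
    "('a::complex_hilbert_space \<Rightarrow>\<^sub>L 'a) \<Rightarrow> real \<Rightarrow> ('a \<Rightarrow>\<^sub>L 'a)" where
  "op_powr A t = (if t = 0 then id_blinfun else cont_calculus (\<lambda>x. x powr t) A)"

text \<open>A partial isometry is isometric on the orthogonal complement of its kernel.\<close>

definition partial_isometry :: "('a::complex_hilbert_space \<Rightarrow>\<^sub>L 'a) \<Rightarrow> bool" where
  "partial_isometry V \<longleftrightarrow> clinear_op V \<and>
     (\<forall>x. (\<forall>y. V y = 0 \<longrightarrow> cinner x y = 0) \<longrightarrow> norm (V x) = norm x)"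

text \<open>The partial isometry \<open>V\<close> of the canonical polar decomposition \<open>T = V |T|\<close>.\<close>

definition polar_part ::
    "('a::complex_hilbert_space \<Rightarrow>\<^sub>L 'a) \<Rightarrow> ('a \<Rightarrow>\<^sub>L 'a)" where
  "polar_part T = (THE V. partial_isometry V \<and> (\<forall>x. V x = 0 \<longleftrightarrow> T x = 0) \<and>
     T = V o\<^sub>L abs_op T)"

definition aluthge ::
    "real \<Rightarrow> ('a::complex_hilbert_space \<Rightarrow>\<^sub>L 'a) \<Rightarrow> ('a \<Rightarrow>\<^sub>L 'a)" where
  "aluthge t T = op_powr (abs_op T) t o\<^sub>L polar_part T o\<^sub>L op_powr (abs_op T) (1 - t)"

end

theory Submission
  imports Defs "HOL-Complex_Analysis.Cauchy_Integral_Formula"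
    "HOL-Computational_Algebra.Fundamental_Theorem_Algebra"
begin

text \<open>
  For a positive operator \<open>S\<close> the powers satisfy \<open>\<parallel>S\<^sup>t\<parallel> \<parallel>S\<^sup>1\<^sup>-\<^sup>t\<parallel> \<le> \<parallel>S\<parallel>\<close>, so the transform does not
  increase the norm and the norms of the iterates decrease to a limit. Writing \<open>T = X Y\<close> with
  \<open>X = V |T|\<^sup>1\<^sup>-\<^sup>t\<close> and \<open>Y = |T|\<^sup>t\<close>, the transform is \<open>Y X\<close>, which has the same nonzero spectrum as
  \<open>X Y\<close>; hence every point of the spectrum of \<open>T\<close> is bounded by the norm of every iterate. The spectrum
  is nonempty by Liouville's theorem. The functional calculus rests on \<open>\<parallel>p(A)\<parallel> = |p(x)|\<close> for some \<open>x\<close>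
  in the spectrum of the self-adjoint operator \<open>A\<close>, obtained by factoring \<open>p - s\<close> over the complex
  numbers for a real \<open>s\<close> in the spectrum of \<open>p(A)\<close> with \<open>|s| = \<parallel>p(A)\<parallel>\<close>.
\<close>

section \<open>Riesz representation and adjoints\<close>

lemma cinner_add_right: "cinner x (y + z) = cinner x y + cinner x z"
  by (metis cinner_add_left cinner_commute complex_cnj_add)

lemma cinner_scaleC_right: "cinner x (a *\<^sub>C y) = cnj a * cinner x y"
  by (metis cinner_commute cinner_scaleC_left complex_cnj_mult)

lemma scaleC_real: "complex_of_real r *\<^sub>C x = r *\<^sub>R x"
  by (simp add: scaleR_scaleC)

lemma cinner_scaleR_left: "cinner (r *\<^sub>R x) y = of_real r * cinner x y"
  by (simp add: scaleR_scaleC cinner_scaleC_left)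

lemma cinner_scaleR_right: "cinner x (r *\<^sub>R y) = of_real r * cinner x y"
  by (simp add: scaleR_scaleC cinner_scaleC_right)

lemma cinner_minus_left: "cinner (- x) y = - cinner x y"
  using cinner_scaleR_left[of "-1" x y] by simp

lemma cinner_minus_right: "cinner x (- y) = - cinner x y"
  using cinner_scaleR_right[of x "-1" y] by simp

lemma cinner_diff_left: "cinner (x - y) z = cinner x z - cinner y z"
  using cinner_add_left[of x "-y" z] by (simp add: cinner_minus_left)

lemma cinner_diff_right: "cinner x (y - z) = cinner x y - cinner x z"
  using cinner_add_right[of x y "-z"] by (simp add: cinner_minus_right)

lemma cinner_zero_left [simp]: "cinner 0 y = 0"
  using cinner_scaleR_left[of 0 0 y] by simp

lemma cinner_zero_right [simp]: "cinner x 0 = 0"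
  using cinner_scaleR_right[of x 0 0] by simp

text \<open>Bounded operators are real-linear maps here, so the existence arguments run over this
  real inner product; complex statements are recovered by following multiplication with the
  imaginary unit.\<close>

definition rinner :: "'a::complex_hilbert_space \<Rightarrow> 'a \<Rightarrow> real" where
  "rinner x y = Re (cinner x y)"

lemma rinner_commute: "rinner x y = rinner y x"
  unfolding rinner_def by (subst cinner_commute) simp

lemma rinner_simps:
  "rinner (x + y) z = rinner x z + rinner y z"
  "rinner x (y + z) = rinner x y + rinner x z"
  "rinner (x - y) z = rinner x z - rinner y z"
  "rinner x (y - z) = rinner x y - rinner x z"
  "rinner (r *\<^sub>R x) y = r * rinner x y"
  "rinner x (r *\<^sub>R y) = r * rinner x y"
  "rinner (- x) y = - rinner x y"
  "rinner x (- y) = - rinner x y"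
  by (simp_all add: rinner_def cinner_add_left cinner_add_right cinner_diff_left cinner_diff_right
      cinner_scaleR_left cinner_scaleR_right cinner_minus_left cinner_minus_right)

lemma rinner_zero [simp]: "rinner 0 y = 0" "rinner x 0 = 0"
  by (simp_all add: rinner_def)

lemma rinner_self: "rinner x x = (norm x)\<^sup>2"
proof -
  \<comment> \<open>Positivity is not among the class axioms. The real \<open>sqrt\<close> preserves
    signs, so it follows from \<open>norm x\<close> being nonnegative.\<close>
  have "0 \<le> Re (cinner x x)"
    using norm_ge_zero[of x] by (simp only: norm_eq_sqrt_cinner real_sqrt_ge_0_iff)
  then show ?thesis by (simp add: rinner_def norm_eq_sqrt_cinner)
qed

lemma norm_add_square: "(norm (x + y))\<^sup>2 = (norm x)\<^sup>2 + 2 * rinner x y + (norm y)\<^sup>2"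
  by (simp add: rinner_self[symmetric] rinner_simps rinner_commute[of y x])

lemma norm_diff_square: "(norm (x - y))\<^sup>2 = (norm x)\<^sup>2 - 2 * rinner x y + (norm y)\<^sup>2"
  by (simp add: rinner_self[symmetric] rinner_simps rinner_commute[of y x])

text \<open>Cauchy-Schwarz, read off by squaring the triangle inequality, which the normed space
  structure already supplies.\<close>

lemma rinner_le_norm: "rinner x y \<le> norm x * norm y"
proof -
  have "(norm (x + y))\<^sup>2 \<le> (norm x + norm y)\<^sup>2"
    by (intro power_mono norm_triangle_ineq) simp
  then show ?thesis unfolding norm_add_square by (simp add: power2_sum)
qed

lemma abs_rinner_le_norm: "\<bar>rinner x y\<bar> \<le> norm x * norm y"
  using rinner_le_norm[of x y] rinner_le_norm[of "-x" y] by (simp add: rinner_simps)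

lemma bounded_bilinear_rinner: "bounded_bilinear rinner"
proof
  show "\<exists>K. \<forall>a b. norm (rinner a b) \<le> norm a * norm b * K"
    by (rule exI[of _ 1]) (simp add: abs_rinner_le_norm)
qed (simp_all add: rinner_simps)

lemma tendsto_rinner:
  "(f \<longlongrightarrow> a) F \<Longrightarrow> (g \<longlongrightarrow> b) F \<Longrightarrow> ((\<lambda>x. rinner (f x) (g x)) \<longlongrightarrow> rinner a b) F"
  by (rule bounded_bilinear.tendsto[OF bounded_bilinear_rinner])

lemma rinner_scaleC_i: "rinner (\<i> *\<^sub>C x) y = - Im (cinner x y)"
  by (simp add: rinner_def cinner_scaleC_left)

lemma cinner_eq_rinner: "cinner x y = Complex (rinner x y) (- rinner (\<i> *\<^sub>C x) y)"
  by (simp add: complex_eq_iff rinner_scaleC_i) (simp add: rinner_def)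

lemma norm_scaleC: "norm (a *\<^sub>C x) = cmod a * norm (x :: 'a::complex_hilbert_space)"
proof -
  have "cinner (a *\<^sub>C x) (a *\<^sub>C x) = complex_of_real ((cmod a)\<^sup>2) * cinner x x"
    by (simp only: complex_norm_square) (simp add: cinner_scaleC_left cinner_scaleC_right)
  then have "(norm (a *\<^sub>C x))\<^sup>2 = (cmod a * norm x)\<^sup>2"
    unfolding rinner_self[symmetric] power_mult_distrib by (simp add: rinner_def)
  then show ?thesis by (simp add: power2_eq_iff_nonneg)
qed

text \<open>The factor 2 comes from bounding real and imaginary parts separately; the estimate
  serves continuity and decay arguments.\<close>

lemma cmod_cinner_le: "cmod (cinner x y) \<le> 2 * (norm x * norm y)"
proof -
  have "cmod (cinner x y) \<le> \<bar>Re (cinner x y)\<bar> + \<bar>Im (cinner x y)\<bar>"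
    by (rule cmod_le)
  then show ?thesis
    using abs_rinner_le_norm[of x y] abs_rinner_le_norm[of "\<i> *\<^sub>C x" y]
    by (simp add: rinner_scaleC_i norm_scaleC) (simp add: rinner_def)
qed

lemma eq_if_rinner_eq:
  assumes "\<And>z. rinner x z = rinner y z"
  shows "x = y"
proof -
  have "(norm (x - y))\<^sup>2 = 0"
    unfolding rinner_self[symmetric] using assms[of "x - y"] by (simp add: rinner_simps(3))
  then show ?thesis by simp
qed

section \<open>Complex-linear bounded operators\<close>

lemma clinear_op_iff: "clinear_op T \<longleftrightarrow> (\<forall>a x. blinfun_apply T (a *\<^sub>C x) = a *\<^sub>C blinfun_apply T x)"
  unfolding clinear_op_def
  by (auto simp: Vector_Spaces.linear_iff blinfun.add_right complex_vector.vector_space_axioms)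

lemma clinear_op_scaleC: "clinear_op T \<Longrightarrow> blinfun_apply T (a *\<^sub>C x) = a *\<^sub>C blinfun_apply T x"
  by (simp add: clinear_op_iff)

lemma scaleC_eq_Re_Im: "a *\<^sub>C x = Re a *\<^sub>R x + Im a *\<^sub>R \<i> *\<^sub>C x"
proof -
  have "a *\<^sub>C x = (complex_of_real (Re a) + complex_of_real (Im a) * \<i>) *\<^sub>C x"
    by (simp add: complex_eq mult.commute)
  then show ?thesis
    by (simp only: scaleC_add_left scaleR_scaleC scaleC_scaleC)
qed

lemma clinear_op_if_scaleC_i:
  fixes T :: "'a::complex_hilbert_space \<Rightarrow>\<^sub>L 'a"
  assumes "\<And>x. T (\<i> *\<^sub>C x) = \<i> *\<^sub>C T x"
  shows "clinear_op T"
  unfolding clinear_op_iff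
proof (intro allI)
  fix a x
  show "T (a *\<^sub>C x) = a *\<^sub>C T x"
    unfolding scaleC_eq_Re_Im[of a x] scaleC_eq_Re_Im[of a "T x"]
    by (simp only: blinfun.add_right blinfun.scaleR_right assms)
qed

text \<open>
  The functional \<open>h \<mapsto> \<parallel>S h\<parallel>\<^sup>2 - 2 g h\<close> is bounded below, and by the parallelogram law the images
  under \<open>S\<close> of a minimising sequence form a Cauchy sequence. Taking \<open>S\<close> to be the identity gives the
  Riesz representation theorem, and \<open>g h = \<langle>x, S h\<rangle>\<close> the orthogonal projection onto the closure of
  the range of \<open>S\<close>.
\<close>

lemma riesz_closure_range:
  fixes S :: "'b::real_vector \<Rightarrow> 'a::complex_hilbert_space" and g :: "'b \<Rightarrow> real"
  assumes S: "linear S" and g: "linear g" and bound: "\<And>h. \<bar>g h\<bar> \<le> C * norm (S h)"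
  obtains m where "m \<in> closure (range S)" "\<And>h. rinner m (S h) = g h"
proof -
  define J where "J h = (norm (S h))\<^sup>2 - 2 * g h" for h
  have J_ge: "- C\<^sup>2 \<le> J h" for h
  proof -
    have "0 \<le> (norm (S h) - C)\<^sup>2" by simp
    moreover have "g h \<le> C * norm (S h)" using bound[of h] by linarith
    ultimately show ?thesis by (simp add: J_def power2_eq_square algebra_simps)
  qed
  define I where "I = Inf (range J)"
  have bdd: "bdd_below (range J)" by (rule bdd_belowI2) (rule J_ge)
  have I_le: "I \<le> J h" for h unfolding I_def by (intro cInf_lower bdd) simp
  have "\<exists>h. J h < I + inverse (real (Suc n))" for n
  proof -
    have "Inf (range J) < I + inverse (real (Suc n))" by (simp add: I_def)
    then show ?thesis using bdd by (subst (asm) cInf_less_iff) auto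
  qed
  then obtain h where h: "\<And>n. J (h n) < I + inverse (real (Suc n))" by metis
  \<comment> \<open>Parallelogram law, combined with \<open>J\<close> being at least
    \<open>I\<close> at the midpoint of \<open>a\<close> and \<open>b\<close>.\<close>
  have par: "(norm (S a - S b))\<^sup>2 \<le> 2 * (J a + J b - 2 * I)" for a b
  proof -
    have "S ((1/2) *\<^sub>R (a + b)) = (1/2) *\<^sub>R (S a + S b)" "g ((1/2) *\<^sub>R (a + b)) = (1/2) * (g a + g b)"
      by (simp_all add: linear_add[OF S] linear_scale[OF S] linear_add[OF g] linear_scale[OF g]
          scaleR_add_right algebra_simps)
    then have "4 * J ((1/2) *\<^sub>R (a + b)) = (norm (S a + S b))\<^sup>2 - 4 * g a - 4 * g b"
      by (simp add: J_def power_divide)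
    then have "(norm (S a - S b))\<^sup>2 = 2 * (J a + J b - 2 * J ((1/2) *\<^sub>R (a + b)))"
      by (simp add: norm_add_square norm_diff_square J_def)
    then show ?thesis using I_le[of "(1/2) *\<^sub>R (a + b)"] by simp
  qed
  have "Cauchy (\<lambda>n. S (h n))"
  proof (rule metric_CauchyI)
    fix e :: real assume e: "0 < e"
    then have "0 < e\<^sup>2 / 4" by simp
    then obtain N where N: "inverse (real (Suc N)) < e\<^sup>2 / 4" using reals_Archimedean by blast
    have small: "inverse (real (Suc n)) < e\<^sup>2 / 4" if "n \<ge> N" for n
    proof -
      have "inverse (real (Suc n)) \<le> inverse (real (Suc N))"
        using that by (intro le_imp_inverse_le) auto
      then show ?thesis using N by linarith
    qed
    show "\<exists>M. \<forall>m\<ge>M. \<forall>n\<ge>M. dist (S (h m)) (S (h n)) < e"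
    proof (intro exI allI impI)
      fix m n assume mn: "m \<ge> N" "n \<ge> N"
      have "(norm (S (h m) - S (h n)))\<^sup>2 < e\<^sup>2"
      proof -
        have "J (h m) < I + e\<^sup>2 / 4" "J (h n) < I + e\<^sup>2 / 4"
          using h[of m] h[of n] small[OF mn(1)] small[OF mn(2)] by linarith+
        then show ?thesis using par[of "h m" "h n"] by (simp add: field_simps)
      qed
      then show "dist (S (h m)) (S (h n)) < e"
        unfolding dist_norm using e by (intro power_less_imp_less_base[of _ 2 e]) auto
    qed
  qed
  then obtain m where m: "(\<lambda>n. S (h n)) \<longlonglongrightarrow> m" 
    using Cauchy_convergent convergent_def by (metis (no_types))
  have "m \<in> closure (range S)" unfolding closure_sequential using m by (intro exI[of _ "\<lambda>n. S (h n)"]) auto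
  moreover have "rinner m (S k) = g k" for k
  proof -
    define e where "e = rinner m (S k) - g k"
    define N where "N = (norm (S k))\<^sup>2"
    \<comment> \<open>First variation: \<open>J (h n + s *\<^sub>R k)\<close> is at least
      \<open>I\<close> while \<open>J (h n)\<close> approaches \<open>I\<close>, so the increment is
      nonnegative in the limit.\<close>
    have nonneg: "0 \<le> 2 * s * e + s\<^sup>2 * N" for s
    proof -
      have "0 \<le> inverse (real (Suc n)) + 2 * s * (rinner (S (h n)) (S k) - g k) + s\<^sup>2 * N" for n
      proof -
        have "J (h n + s *\<^sub>R k) = J (h n) + 2 * s * (rinner (S (h n)) (S k) - g k) + s\<^sup>2 * N"
          by (simp add: J_def linear_add[OF S] linear_scale[OF S] linear_add[OF g] linear_scale[OF g]
              norm_add_square rinner_simps N_def power_mult_distrib algebra_simps)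
        then show ?thesis using I_le[of "h n + s *\<^sub>R k"] h[of n] by linarith
      qed
      moreover have "(\<lambda>n. inverse (real (Suc n)) + 2 * s * (rinner (S (h n)) (S k) - g k) + s\<^sup>2 * N)
          \<longlonglongrightarrow> 0 + 2 * s * e + s\<^sup>2 * N"
        unfolding e_def by (intro tendsto_intros LIMSEQ_inverse_real_of_nat tendsto_rinner m)
      ultimately show ?thesis
        by (metis (no_types, lifting) LIMSEQ_le_const add_0)
    qed
    have N0: "N \<ge> 0" by (simp add: N_def)
    \<comment> \<open>A small step against the sign of \<open>e\<close> makes the linear term
      dominate; the denominator \<open>N + 1\<close> also covers \<open>N = 0\<close>.\<close>
    have "0 \<le> (2 * (- e / (N + 1)) * e + (- e / (N + 1))\<^sup>2 * N) * (N + 1)\<^sup>2"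
      by (intro mult_nonneg_nonneg nonneg) simp
    also have "\<dots> = e\<^sup>2 * (- N - 2)"
      using N0 by (simp add: field_simps power2_eq_square add_nonneg_eq_0_iff)
    finally have "e = 0" using N0 by (simp add: zero_le_mult_iff)
    then show ?thesis by (simp add: e_def)
  qed
  ultimately show ?thesis using that by blast
qed

text \<open>The adjoint at \<open>y\<close> represents the functional sending \<open>x\<close> to
  \<open>rinner (T x) y\<close>, by the Riesz theorem; linearity of the result follows from
  nondegeneracy.\<close>

lemma adjoint_exists:
  fixes T :: "'a::complex_hilbert_space \<Rightarrow>\<^sub>L 'a"
  shows "\<exists>S :: 'a \<Rightarrow>\<^sub>L 'a. \<forall>x y. rinner (T x) y = rinner x (S y)"
proof -
  have "\<exists>m. \<forall>x. rinner (T x) y = rinner x m" for y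
  proof -
    have lin: "linear (\<lambda>x. rinner (T x) y)"
      by (rule linearI) (simp_all add: blinfun.add_right blinfun.scaleR_right rinner_simps)
    have bound: "\<bar>rinner (T x) y\<bar> \<le> (norm T * norm y) * norm x" for x
    proof -
      have "\<bar>rinner (T x) y\<bar> \<le> norm (T x) * norm y" by (rule abs_rinner_le_norm)
      also have "\<dots> \<le> (norm T * norm x) * norm y" by (intro mult_right_mono norm_blinfun) simp
      finally show ?thesis by (simp add: mult_ac)
    qed
    obtain m where m: "\<And>x. rinner m x = rinner (T x) y"
      by (rule riesz_closure_range[OF linear_ident lin bound]) blast
    show ?thesis by (rule exI[of _ m]) (simp add: m rinner_commute[of _ m])
  qed
  then obtain f where f: "\<And>x y. rinner (T x) y = rinner x (f y)" by metis
  have "bounded_linear f"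
  proof (rule bounded_linear_intro[where K = "norm T"])
    show "f (x + y) = f x + f y" for x y
      by (rule eq_if_rinner_eq)
        (simp add: rinner_simps rinner_commute[of "f _"] f[symmetric])
    show "f (r *\<^sub>R x) = r *\<^sub>R f x" for r x
      by (rule eq_if_rinner_eq)
        (simp add: rinner_simps rinner_commute[of "f _"] f[symmetric])
    show "norm (f x) \<le> norm x * norm T" for x
    proof (cases "f x = 0")
      case False
      have "norm (f x) * norm (f x) = rinner (T (f x)) x"
        by (simp add: f rinner_self power2_eq_square)
      also have "\<dots> \<le> norm (T (f x)) * norm x" by (rule rinner_le_norm)
      also have "\<dots> \<le> (norm T * norm (f x)) * norm x" by (intro mult_right_mono norm_blinfun) simp
      finally show ?thesis using False by (simp add: mult_ac)
    qed simp
  qed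
  then show ?thesis using f by (intro exI[of _ "Blinfun f"]) (simp add: bounded_linear_Blinfun_apply)
qed

text \<open>The imaginary part of the inner product is, up to sign, the real inner product with the
  first argument multiplied by \<open>\<i>\<close>.\<close>

lemma cinner_eq_if_rinner_eq:
  assumes "\<And>x y. rinner (F x) y = rinner x (G y)" "\<And>x. F (\<i> *\<^sub>C x) = \<i> *\<^sub>C F x"
  shows "cinner (F x) y = cinner x (G y)"
  using assms(1)[of x y] assms(1)[of "\<i> *\<^sub>C x" y] assms(2)[of x] by (simp add: cinner_eq_rinner)

text \<open>The definite description in \<open>adjoint_op\<close> is meaningful: the real adjoint is
  also the complex one, and nondegeneracy makes it unique.\<close>

lemma adjoint_op:
  fixes T :: "'a::complex_hilbert_space \<Rightarrow>\<^sub>L 'a"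
  assumes "clinear_op T"
  shows "cinner (T x) y = cinner x (adjoint_op T y)"
proof -
  obtain S :: "'a \<Rightarrow>\<^sub>L 'a" where S: "\<And>x y. cinner (T x) y = cinner x (S y)"
    using adjoint_exists[of T] cinner_eq_if_rinner_eq[of T] clinear_op_scaleC[OF assms] by metis
  have "adjoint_op T = S"
    unfolding adjoint_op_def
  proof (rule the_equality)
    fix S' :: "'a \<Rightarrow>\<^sub>L 'a" assume S': "\<forall>x y. cinner (T x) y = cinner x (S' y)"
    show "S' = S"
    proof (rule blinfun_eqI, rule eq_if_rinner_eq)
      fix y z show "rinner (S' y) z = rinner (S y) z"
        using S S' by (metis rinner_commute rinner_def)
    qed
  qed (use S in blast)
  then show ?thesis using S by simp
qed

lemma adjoint_op_rinner: "clinear_op T \<Longrightarrow> rinner (blinfun_apply T x) y = rinner x (adjoint_op T y)"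
  by (simp add: rinner_def adjoint_op)

lemma clinear_op_if_adjoint:
  assumes "\<And>x y. cinner (F x) y = cinner x (blinfun_apply S y)"
    "\<And>x. F (\<i> *\<^sub>C x) = \<i> *\<^sub>C F x"
  shows "clinear_op S"
proof (rule clinear_op_if_scaleC_i)
  fix y show "S (\<i> *\<^sub>C y) = \<i> *\<^sub>C S y"
  proof (rule eq_if_rinner_eq)
    fix x
    have "cinner x (S (\<i> *\<^sub>C y)) = cinner x (\<i> *\<^sub>C S y)"
      by (simp add: assms(1)[symmetric] cinner_scaleC_right)
    then show "rinner (S (\<i> *\<^sub>C y)) x = rinner (\<i> *\<^sub>C S y) x"
      by (metis rinner_commute rinner_def)
  qed
qed

lemma clinear_op_adjoint: "clinear_op T \<Longrightarrow> clinear_op (adjoint_op T)"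
  by (rule clinear_op_if_adjoint[OF adjoint_op clinear_op_scaleC])

lemma adjoint_op_unique:
  fixes T S :: "'a::complex_hilbert_space \<Rightarrow>\<^sub>L 'a"
  assumes "clinear_op T" "\<And>x y. rinner (T x) y = rinner x (S y)"
  shows "adjoint_op T = S"
proof (rule blinfun_eqI, rule eq_if_rinner_eq)
  fix y z show "rinner (adjoint_op T y) z = rinner (S y) z"
    using assms by (metis adjoint_op_rinner rinner_commute)
qed

lemma norm_adjoint_op_le:
  fixes T :: "'a::complex_hilbert_space \<Rightarrow>\<^sub>L 'a"
  assumes "clinear_op T"
  shows "norm (adjoint_op T y) \<le> norm T * norm y"
proof (cases "adjoint_op T y = 0")
  case False
  have "norm (adjoint_op T y) * norm (adjoint_op T y) = rinner (T (adjoint_op T y)) y"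
    by (simp add: adjoint_op_rinner assms rinner_self power2_eq_square)
  also have "\<dots> \<le> norm (T (adjoint_op T y)) * norm y" by (rule rinner_le_norm)
  also have "\<dots> \<le> (norm T * norm (adjoint_op T y)) * norm y"
    by (intro mult_right_mono norm_blinfun) simp
  finally show ?thesis using False by (simp add: mult_ac)
qed simp

section \<open>Spectrum\<close>

text \<open>Stated for plain functions, so that it applies directly to compositions written
  pointwise.\<close>

definition boundedly_invertible :: "('a::complex_hilbert_space \<Rightarrow> 'a) \<Rightarrow> bool" where
  "boundedly_invertible F \<longleftrightarrow>
     (\<exists>S :: 'a \<Rightarrow>\<^sub>L 'a. clinear_op S \<and> (\<forall>x. S (F x) = x) \<and> (\<forall>x. F (S x) = x))"

definition scaleC_op :: "complex \<Rightarrow> ('a::complex_hilbert_space \<Rightarrow>\<^sub>L 'a)" where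
  "scaleC_op z = Blinfun (\<lambda>x. z *\<^sub>C x)"

lemma scaleC_op_apply [simp]: "scaleC_op z x = z *\<^sub>C x"
proof -
  have "bounded_linear (\<lambda>x::'a. z *\<^sub>C x)"
    by (rule bounded_linear_intro[where K = "cmod z"])
      (simp_all add: scaleC_add_right norm_scaleC scaleR_scaleC scaleC_scaleC mult.commute)
  then show ?thesis by (simp add: scaleC_op_def bounded_linear_Blinfun_apply)
qed

lemma in_op_spectrum_iff:
  "z \<in> op_spectrum T \<longleftrightarrow> \<not> boundedly_invertible (blinfun_apply (T - scaleC_op z))"
  by (simp add: op_spectrum_def boundedly_invertible_def blinfun.diff_left)

lemma clinear_op_diff: "clinear_op S \<Longrightarrow> clinear_op T \<Longrightarrow> clinear_op (S - T)"
  by (simp add: clinear_op_iff blinfun.diff_left complex_vector.scale_right_diff_distrib)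

lemma clinear_op_scaleC_op: "clinear_op (scaleC_op z)"
  by (simp add: clinear_op_iff scaleC_scaleC mult.commute)

lemma clinear_op_compose: "clinear_op S \<Longrightarrow> clinear_op T \<Longrightarrow> clinear_op (S o\<^sub>L T)"
  by (simp add: clinear_op_iff)

lemma clinear_op_id: "clinear_op id_blinfun"
  by (simp add: clinear_op_iff)

lemma adjoint_op_shift:
  assumes "clinear_op T"
  shows "adjoint_op (T - scaleC_op z) = adjoint_op T - scaleC_op (cnj z)"
proof (rule adjoint_op_unique)
  show "rinner ((T - scaleC_op z) x) y = rinner x ((adjoint_op T - scaleC_op (cnj z)) y)" for x y
    by (simp add: blinfun.diff_left rinner_simps adjoint_op_rinner[OF assms])
      (simp add: rinner_def cinner_scaleC_left cinner_scaleC_right)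
qed (intro clinear_op_diff assms clinear_op_scaleC_op)

text \<open>The bound for \<open>B\<close> gives injectivity and a bounded inverse. The bound for
  the adjoint gives surjectivity: the Riesz argument along the adjoint solves
  \<open>rinner m (adjoint_op B h) = rinner y h\<close> for all \<open>h\<close>, which says
  \<open>B m = y\<close>.\<close>

lemma boundedly_invertible_if_bounded_below:
  fixes B :: "'a::complex_hilbert_space \<Rightarrow>\<^sub>L 'a"
  assumes B: "clinear_op B" and c: "0 < c"
    and below: "\<And>x. c * norm x \<le> norm (B x)"
    and below_adj: "\<And>x. c * norm x \<le> norm (adjoint_op B x)"
  shows "boundedly_invertible B"
proof -
  have surj: "\<exists>m. B m = y" for y
  proof -
    have lin: "linear (blinfun_apply (adjoint_op B))" and lin': "linear (rinner y)"
      by (auto intro!: linearI simp: blinfun.add_right blinfun.scaleR_right rinner_simps)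
    have bound: "\<bar>rinner y h\<bar> \<le> (norm y / c) * norm (adjoint_op B h)" for h
    proof -
      have "\<bar>rinner y h\<bar> \<le> norm y * norm h" by (rule abs_rinner_le_norm)
      also have "\<dots> \<le> norm y * (norm (adjoint_op B h) / c)"
        using below_adj[of h] c by (intro mult_left_mono) (auto simp: field_simps)
      finally show ?thesis by simp
    qed
    obtain m where m: "\<And>h. rinner m (adjoint_op B h) = rinner y h"
      by (rule riesz_closure_range[OF lin lin' bound]) blast
    have "B m = y" by (rule eq_if_rinner_eq) (simp add: adjoint_op_rinner[OF B] m)
    then show ?thesis by blast
  qed
  have inj: "x = y" if "B x = B y" for x y
  proof -
    have "c * norm (x - y) \<le> 0" using below[of "x - y"] that by (simp add: blinfun.diff_right)
    then show ?thesis using c by (simp add: mult_le_0_iff)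
  qed
  obtain f where f: "\<And>y. B (f y) = y" using surj by metis
  have lin: "bounded_linear f"
  proof (rule bounded_linear_intro[where K = "1 / c"])
    show "f (x + y) = f x + f y" for x y by (rule inj) (simp add: blinfun.add_right f)
    show "f (r *\<^sub>R x) = r *\<^sub>R f x" for r x by (rule inj) (simp add: blinfun.scaleR_right f)
    show "norm (f x) \<le> norm x * (1 / c)" for x using below[of "f x"] c by (simp add: f field_simps)
  qed
  have "clinear_op (Blinfun f)"
    unfolding clinear_op_iff bounded_linear_Blinfun_apply[OF lin]
  proof (intro allI)
    show "f (a *\<^sub>C x) = a *\<^sub>C f x" for a x by (rule inj) (simp add: clinear_op_scaleC[OF B] f)
  qed
  moreover have "f (B x) = x" for x by (rule inj) (simp add: f)
  ultimately show ?thesis unfolding boundedly_invertible_def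
    by (intro exI[of _ "Blinfun f"]) (simp add: bounded_linear_Blinfun_apply[OF lin] f)
qed

lemma not_in_op_spectrumI:
  fixes T :: "'a::complex_hilbert_space \<Rightarrow>\<^sub>L 'a"
  assumes "clinear_op T" "0 < c"
    and "\<And>x. c * norm x \<le> norm (T x - z *\<^sub>C x)"
    and "\<And>x. c * norm x \<le> norm (adjoint_op T x - cnj z *\<^sub>C x)"
  shows "z \<notin> op_spectrum T"
  unfolding in_op_spectrum_iff not_not
  using assms
  by (intro boundedly_invertible_if_bounded_below[where c = c])
    (simp_all add: clinear_op_diff clinear_op_scaleC_op adjoint_op_shift blinfun.diff_left)

lemma norm_shift_ge:
  assumes "norm y \<le> K * norm x"
  shows "(cmod z - K) * norm x \<le> norm (y - z *\<^sub>C x)"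
  using norm_triangle_ineq2[of "z *\<^sub>C x" y] assms by (simp add: norm_scaleC norm_minus_commute algebra_simps)

lemma cmod_le_norm_if_in_op_spectrum:
  fixes T :: "'a::complex_hilbert_space \<Rightarrow>\<^sub>L 'a"
  assumes T: "clinear_op T" and z: "z \<in> op_spectrum T"
  shows "cmod z \<le> norm T"
proof (rule ccontr)
  assume "\<not> cmod z \<le> norm T"
  then have "z \<notin> op_spectrum T"
    using norm_shift_ge[OF norm_blinfun[of T], of z]
      norm_shift_ge[OF norm_adjoint_op_le[OF T], of "cnj z"]
    by (intro not_in_op_spectrumI[OF T, of "cmod z - norm T"]) simp_all
  then show False using z by blast
qed

text \<open>With empty spectrum the resolvent is defined on the whole plane, and its matrix entries
  are entire functions vanishing at infinity. By Liouville they are zero, although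
  \<open>R 0 x\<close> is mapped by \<open>T\<close> to the nonzero vector \<open>x\<close>.\<close>

lemma op_spectrum_nonempty:
  fixes T :: "'a::complex_hilbert_space \<Rightarrow>\<^sub>L 'a"
  assumes "clinear_op T" and nz: "(x :: 'a) \<noteq> 0"
  shows "op_spectrum T \<noteq> {}"
proof
  assume empty: "op_spectrum T = {}"
  have "\<exists>S :: 'a \<Rightarrow>\<^sub>L 'a. clinear_op S \<and>
     (\<forall>x. S (T x - z *\<^sub>C x) = x) \<and> (\<forall>x. T (S x) - z *\<^sub>C S x = x)" for z
    using empty unfolding op_spectrum_def by blast
  then obtain R :: "complex \<Rightarrow> ('a \<Rightarrow>\<^sub>L 'a)" where R_lin: "\<And>z. clinear_op (R z)"
    and R_left: "\<And>z x. R z (T x - z *\<^sub>C x) = x" and R_right: "\<And>z x. T (R z x) - z *\<^sub>C R z x = x"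
    by metis
  \<comment> \<open>First resolvent identity: apply \<open>R z\<close> to \<open>x\<close>, written
    through \<open>u\<close> and the shift from \<open>w\<close> to \<open>z\<close>.\<close>
  have resolvent: "R z x - R w x = (z - w) *\<^sub>C R z (R w x)" for z w x
  proof -
    define u where "u = R w x"
    have "x = (T u - z *\<^sub>C u) + (z - w) *\<^sub>C u"
      using R_right[of w x] by (simp add: u_def complex_vector.scale_left_diff_distrib)
    then have "R z x = R z (T u - z *\<^sub>C u) + (z - w) *\<^sub>C R z u"
      by (metis blinfun.add_right clinear_op_scaleC[OF R_lin])
    then show ?thesis by (simp add: R_left u_def)
  qed
  \<comment> \<open>Near \<open>w\<close> the resolvent identity bounds \<open>norm (R z)\<close> by
    \<open>norm (R w)\<close> plus half of itself, and that half is absorbed.\<close>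
  have R_bound: "\<forall>\<^sub>F z in at w. norm (R z) \<le> 2 * norm (R w)" for w
  proof -
    have pos: "0 < 2 * (norm (R w) + 1)" by (intro mult_pos_pos add_nonneg_pos norm_ge_zero) simp_all
    then have "0 < 1 / (2 * (norm (R w) + 1))" by simp
    moreover have "norm (R z) \<le> 2 * norm (R w)" if z: "dist z w < 1 / (2 * (norm (R w) + 1))" for z
    proof -
      have "cmod (z - w) * norm (R w) \<le> cmod (z - w) * (norm (R w) + 1)"
        by (intro mult_left_mono) auto
      also have "\<dots> \<le> 1/2" using z pos by (simp add: dist_norm field_simps)
      finally have small: "cmod (z - w) * norm (R w) \<le> 1/2" .
      have "norm (R z) \<le> norm (R w) + 1/2 * norm (R z)"
      proof (rule norm_blinfun_bound)
        fix x
        have "R z x = R w x + (z - w) *\<^sub>C R z (R w x)" using resolvent[of z x w] by (simp add: algebra_simps)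
        then have "norm (R z x) \<le> norm (R w x) + cmod (z - w) * norm (R z (R w x))"
          by (metis norm_triangle_ineq norm_scaleC)
        also have "\<dots> \<le> norm (R w) * norm x + cmod (z - w) * (norm (R z) * (norm (R w) * norm x))"
          by (intro add_mono mult_left_mono norm_blinfun
              order.trans[OF norm_blinfun] norm_ge_zero)
        also have "\<dots> = (norm (R w) + (cmod (z - w) * norm (R w)) * norm (R z)) * norm x"
          by (simp add: algebra_simps)
        also have "\<dots> \<le> (norm (R w) + 1/2 * norm (R z)) * norm x"
          by (intro mult_right_mono add_left_mono small norm_ge_zero)
        finally show "norm (R z x) \<le> (norm (R w) + 1/2 * norm (R z)) * norm x" .
      qed simp
      then show ?thesis by simp
    qed
    ultimately show ?thesis unfolding eventually_at by blast
  qed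
  have "R 0 x = 0"
  proof (rule eq_if_rinner_eq)
    fix y
    define f where "f z = cinner (R z x) y" for z
    \<comment> \<open>By the resolvent identity the difference quotient is
      \<open>cinner (R z v) y\<close>. A second use of the identity with the local bound shows that
      this is continuous at \<open>w\<close>.\<close>
    have deriv: "(f has_field_derivative cinner (R w (R w x)) y) (at w)" for w
    proof -
      define v where "v = R w x"
      define K where "K = 2 * (2 * norm (R w) * norm (R w v) * norm y)"
      have "((\<lambda>z. cinner (R z v) y - cinner (R w v) y) \<longlongrightarrow> 0) (at w)"
      proof (rule Lim_null_comparison)
        show "\<forall>\<^sub>F z in at w. norm (cinner (R z v) y - cinner (R w v) y) \<le> cmod (z - w) * K"
          using R_bound[of w]
        proof eventually_elim
          case (elim z)
          have "cinner (R z v) y - cinner (R w v) y = (z - w) * cinner (R z (R w v)) y"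
            by (simp add: cinner_diff_left[symmetric] resolvent cinner_scaleC_left)
          moreover have "cmod (cinner (R z (R w v)) y) \<le> 2 * (norm (R z (R w v)) * norm y)"
            by (rule cmod_cinner_le)
          moreover have "norm (R z (R w v)) * norm y \<le> (2 * norm (R w) * norm (R w v)) * norm y"
            by (intro mult_right_mono order.trans[OF norm_blinfun] elim) auto
          ultimately show ?case
            by (simp add: norm_mult K_def) (intro mult_left_mono, auto)
        qed
        have "((\<lambda>z. cmod (z - w) * K) \<longlongrightarrow> cmod (w - w) * K) (at w)" by (intro tendsto_intros)
        then show "((\<lambda>z. cmod (z - w) * K) \<longlongrightarrow> 0) (at w)" by simp
      qed
      then have "((\<lambda>z. cinner (R z v) y) \<longlongrightarrow> cinner (R w v) y) (at w)" by (simp add: LIM_zero_iff)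
      moreover have "\<forall>\<^sub>F z in at w. (f z - f w) / (z - w) = cinner (R z v) y"
        unfolding eventually_at_filter
        by (rule always_eventually)
          (simp add: f_def cinner_diff_left[symmetric] resolvent cinner_scaleC_left v_def)
      ultimately show ?thesis
        unfolding has_field_derivative_iff v_def using tendsto_cong by fast
    qed
    have lim: "(f \<longlongrightarrow> 0) at_infinity"
    proof (rule Lim_null_comparison)
      have R_decay: "norm (f z) \<le> 2 * (norm x * norm y) / (- norm T + cmod z)" if "cmod z > norm T" for z
      proof -
        have "(cmod z - norm T) * norm (R z x) \<le> norm (T (R z x) - z *\<^sub>C R z x)"
          by (rule norm_shift_ge[OF norm_blinfun])
        then have "norm (R z x) \<le> norm x / (cmod z - norm T)" using that by (simp add: R_right field_simps)
        then have "norm (R z x) * norm y \<le> norm x / (cmod z - norm T) * norm y"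
          by (rule mult_right_mono) simp
        then show ?thesis using cmod_cinner_le[of "R z x" y] by (simp add: f_def)
      qed
      show "\<forall>\<^sub>F z in at_infinity. norm (f z) \<le> 2 * (norm x * norm y) / (- norm T + cmod z)"
        unfolding eventually_at_infinity using R_decay by (intro exI[of _ "norm T + 1"]) auto
      show "((\<lambda>z. 2 * (norm x * norm y) / (- norm T + cmod z)) \<longlongrightarrow> 0) at_infinity"
        by (intro tendsto_divide_0[OF tendsto_const] filterlim_at_top_imp_at_infinity
            filterlim_tendsto_add_at_top[OF tendsto_const filterlim_norm_at_top])
    qed
    have "f holomorphic_on UNIV" using deriv by (auto simp: holomorphic_on_open)
    then have "f 0 = 0" using lim by (rule Liouville_weak)
    then show "rinner (R 0 x) y = rinner 0 y" by (simp add: f_def rinner_def)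
  qed
  then show False using R_right[of 0 x] nz by simp
qed

section \<open>Polynomials of self-adjoint operators\<close>

definition selfadjoint_op :: "('a::complex_hilbert_space \<Rightarrow>\<^sub>L 'a) \<Rightarrow> bool" where
  "selfadjoint_op A \<longleftrightarrow> clinear_op A \<and> (\<forall>x y. cinner (A x) y = cinner x (A y))"

lemma selfadjoint_op_clinear: "selfadjoint_op A \<Longrightarrow> clinear_op A"
  by (simp add: selfadjoint_op_def)

lemma selfadjoint_op_rinner: "selfadjoint_op A \<Longrightarrow> rinner (blinfun_apply A x) y = rinner x (A y)"
  by (simp add: selfadjoint_op_def rinner_def)

lemma adjoint_op_selfadjoint: "selfadjoint_op A \<Longrightarrow> adjoint_op A = A"
  by (intro adjoint_op_unique selfadjoint_op_clinear selfadjoint_op_rinner)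

text \<open>Since \<open>cinner (A x) x\<close> is real, the imaginary part of
  \<open>cinner (A x - w *\<^sub>C x) x\<close> has modulus \<open>\<bar>Im w\<bar>\<close> times
  the squared norm of \<open>x\<close>. This bounds both \<open>A - z\<close> and its adjoint from
  below.\<close>

lemma op_spectrum_selfadjoint_real:
  fixes A :: "'a::complex_hilbert_space \<Rightarrow>\<^sub>L 'a"
  assumes A: "selfadjoint_op A" and z: "z \<in> op_spectrum A"
  shows "Im z = 0"
proof (rule ccontr)
  assume nz: "Im z \<noteq> 0"
  have below: "\<bar>Im w\<bar> * norm x \<le> norm (A x - w *\<^sub>C x)" for w x
  proof (cases "x = 0")
    case False
    have "Im (cinner (A x) x) = Im (cnj (cinner (A x) x))"
      using A by (metis cinner_commute selfadjoint_op_def)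
    then have "rinner (\<i> *\<^sub>C (A x - w *\<^sub>C x)) x = Im w * (norm x)\<^sup>2 + Re w * Im (cinner x x)"
      unfolding rinner_self[symmetric]
      by (simp add: rinner_scaleC_i cinner_diff_left cinner_scaleC_left rinner_def)
    moreover have "Im (cinner x x) = 0"
      using cinner_commute[of x x] by (metis complex_cnj_cancel_iff complex_is_Real_iff Reals_cnj_iff)
    ultimately have "\<bar>Im w\<bar> * (norm x)\<^sup>2 \<le> norm (A x - w *\<^sub>C x) * norm x"
      using abs_rinner_le_norm[of "\<i> *\<^sub>C (A x - w *\<^sub>C x)" x] by (simp add: norm_scaleC abs_mult)
    then show ?thesis using False by (simp add: power2_eq_square)
  qed simp
  have "z \<notin> op_spectrum A"
    using below[of z] below[of "cnj z"] nz
    by (intro not_in_op_spectrumI[of A "\<bar>Im z\<bar>"])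
      (simp_all add: adjoint_op_selfadjoint A selfadjoint_op_clinear)
  then show False using z by blast
qed

lemma boundedly_invertible_compose:
  assumes "boundedly_invertible F" "boundedly_invertible G"
  shows "boundedly_invertible (\<lambda>x. F (G x))"
proof -
  obtain S T where "clinear_op S" "\<And>x. S (F x) = x" "\<And>x. F (S x) = x"
    and "clinear_op T" "\<And>x. T (G x) = x" "\<And>x. G (T x) = x"
    using assms unfolding boundedly_invertible_def by blast
  then show ?thesis unfolding boundedly_invertible_def
    by (intro exI[of _ "T o\<^sub>L S"]) (simp add: clinear_op_compose)
qed

lemma boundedly_invertible_bounded_below:
  assumes "boundedly_invertible F"
  obtains d where "0 < d" "\<And>x. d * norm x \<le> norm (F x)"
proof -
  obtain S where S: "\<And>x. blinfun_apply S (F x) = x"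
    using assms unfolding boundedly_invertible_def by blast
  have pos: "0 < norm S + 1" by (intro add_nonneg_pos norm_ge_zero) simp
  have "1 / (norm S + 1) * norm x \<le> norm (F x)" for x
  proof -
    have "norm x \<le> norm S * norm (F x)" using norm_blinfun[of S "F x"] by (simp add: S)
    also have "\<dots> \<le> (norm S + 1) * norm (F x)" by (simp add: mult_right_mono)
    finally show ?thesis using pos by (simp add: pos_divide_le_eq mult.commute)
  qed
  then show ?thesis using that[of "1 / (norm S + 1)"] pos by simp
qed

text \<open>
  With \<open>c = \<parallel>A\<parallel>\<close>, a lower bound for \<open>A\<^sup>2 - c\<^sup>2 = (A - c)(A + c)\<close> would make \<open>\<parallel>A x\<parallel>\<^sup>2\<close> at most a
  fixed constant below \<open>c\<^sup>2\<close> times \<open>\<parallel>x\<parallel>\<^sup>2\<close>.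
\<close>

lemma selfadjoint_norm_in_op_spectrum:
  fixes A :: "'a::complex_hilbert_space \<Rightarrow>\<^sub>L 'a"
  assumes A: "selfadjoint_op A" and nz: "(u :: 'a) \<noteq> 0"
  obtains s where "\<bar>s\<bar> = norm A" "complex_of_real s \<in> op_spectrum A"
proof (rule ccontr)
  define c where "c = norm A"
  assume "\<not> thesis"
  then have "complex_of_real c \<notin> op_spectrum A" "complex_of_real (- c) \<notin> op_spectrum A"
    using that[of c] that[of "-c"] by (auto simp: c_def)
  then have "boundedly_invertible (\<lambda>x. (A - scaleC_op c) ((A - scaleC_op (complex_of_real (- c))) x))"
    by (simp only: in_op_spectrum_iff not_not boundedly_invertible_compose)
  then obtain d where d: "0 < d"
      "\<And>x. d * norm x \<le> norm ((A - scaleC_op c) ((A - scaleC_op (complex_of_real (- c))) x))"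
    by (rule boundedly_invertible_bounded_below) blast
  have below: "d * norm x \<le> norm (A (A x) - c\<^sup>2 *\<^sub>R x)" for x
    using d(2)[of x] by (simp add: blinfun.diff_left blinfun.diff_right blinfun.add_right scaleC_real
        blinfun.scaleR_right power2_eq_square algebra_simps)
  \<comment> \<open>Expand the square of the lower bound: self-adjointness turns the mixed term into
    the squared norm of \<open>A x\<close>, and \<open>A (A x)\<close> has norm at most
    \<open>c\<^sup>2\<close> times that of \<open>x\<close>.\<close>
  have key: "d\<^sup>2 * (norm x)\<^sup>2 \<le> 2 * c\<^sup>2 * (c\<^sup>2 * (norm x)\<^sup>2 - (norm (A x))\<^sup>2)" for x
  proof -
    have "d\<^sup>2 * (norm x)\<^sup>2 \<le> (norm (A (A x) - c\<^sup>2 *\<^sub>R x))\<^sup>2"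
      unfolding power_mult_distrib[symmetric] using below d by (intro power_mono) auto
    also have "\<dots> = (norm (A (A x)))\<^sup>2 - 2 * c\<^sup>2 * (norm (A x))\<^sup>2 + c\<^sup>2 * c\<^sup>2 * (norm x)\<^sup>2"
    proof -
      have "rinner (A (A x)) (c\<^sup>2 *\<^sub>R x) = c\<^sup>2 * (norm (A x))\<^sup>2"
        by (simp add: rinner_simps selfadjoint_op_rinner[OF A, of "A x" x] rinner_self)
      then show ?thesis
        by (simp add: norm_diff_square power_mult_distrib)
    qed
    also have "(norm (A (A x)))\<^sup>2 \<le> (c * (c * norm x))\<^sup>2"
      unfolding c_def
      by (intro power_mono order.trans[OF norm_blinfun] mult_left_mono norm_blinfun) auto
    finally show ?thesis by (simp add: power_mult_distrib power2_eq_square algebra_simps)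
  qed
  have "c \<noteq> 0" using key[of u] nz d(1) by (auto simp: mult_le_0_iff power2_eq_square)
  then have c: "0 < c" by (simp add: c_def)
  \<comment> \<open>The estimate \<open>key\<close> solved for the squared norm of
    \<open>A x\<close>; this constant is strictly below \<open>c\<^sup>2\<close>.\<close>
  define k where "k = c\<^sup>2 - d\<^sup>2 / (2 * c\<^sup>2)"
  have k: "(norm (A x))\<^sup>2 \<le> k * (norm x)\<^sup>2" for x
    using key[of x] c by (simp add: k_def field_simps)
  have "0 \<le> k * (norm u)\<^sup>2" using k[of u] zero_le_power2[of "norm (A u)"] by linarith
  then have k0: "0 \<le> k" using nz by (simp add: zero_le_mult_iff)
  have "norm A \<le> sqrt k"
  proof (rule norm_blinfun_bound)
    fix x
    have "(norm (A x))\<^sup>2 \<le> (sqrt k * norm x)\<^sup>2" using k[of x] k0 by (simp add: power_mult_distrib)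
    then show "norm (A x) \<le> sqrt k * norm x" by (rule power2_le_imp_le) (simp add: k0)
  qed (simp add: k0)
  then have "c\<^sup>2 \<le> k" using k0 c by (metis c_def norm_ge_zero power_mono real_sqrt_pow2)
  then show False using c d(1) by (simp add: k_def field_simps)
qed

section \<open>Operator polynomials and spectral mapping\<close>

lemma blinfun_eq_iff: "S = T \<longleftrightarrow> (\<forall>x. blinfun_apply S x = blinfun_apply T x)"
  by (auto intro: blinfun_eqI)

lemma op_poly_eq_sum:
  assumes "degree p \<le> n"
  shows "op_poly p A = (\<Sum>i\<le>n. coeff p i *\<^sub>R op_power A i)"
  unfolding op_poly_def using assms
  by (intro sum.mono_neutral_left) (auto simp: coeff_eq_0)

lemma op_poly_0 [simp]: "op_poly 0 A = 0"
  by (simp add: op_poly_def)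

text \<open>Horner form, the recursion behind the inductions over polynomials.\<close>

lemma op_poly_pCons: "op_poly (pCons a p) A = a *\<^sub>R id_blinfun + (A o\<^sub>L op_poly p A)"
proof -
  have "op_poly (pCons a p) A = (\<Sum>i\<le>Suc (degree p). coeff (pCons a p) i *\<^sub>R op_power A i)"
    by (rule op_poly_eq_sum) (simp add: degree_pCons_le)
  also have "\<dots> = a *\<^sub>R id_blinfun + (\<Sum>i\<le>degree p. coeff p i *\<^sub>R (A o\<^sub>L op_power A i))"
    by (subst sum.atMost_Suc_shift) simp
  also have "(\<Sum>i\<le>degree p. coeff p i *\<^sub>R (A o\<^sub>L op_power A i)) = (A o\<^sub>L op_poly p A)"
    unfolding op_poly_def
    by (simp add: blinfun_eq_iff blinfun.sum_left blinfun.sum_right blinfun.scaleR_left blinfun.scaleR_right)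
  finally show ?thesis .
qed

lemma op_poly_add: "op_poly (p + q) A = op_poly p A + op_poly q A"
proof -
  define n where "n = max (degree p) (degree q)"
  have "degree (p + q) \<le> n" by (simp add: n_def degree_add_le_max)
  then have "op_poly (p + q) A = (\<Sum>i\<le>n. coeff (p + q) i *\<^sub>R op_power A i)" by (rule op_poly_eq_sum)
  also have "\<dots> = op_poly p A + op_poly q A"
    by (simp add: op_poly_eq_sum[of p n] op_poly_eq_sum[of q n] n_def scaleR_add_left sum.distrib)
  finally show ?thesis .
qed

lemma op_poly_smult: "op_poly (smult c p) A = c *\<^sub>R op_poly p A"
  using op_poly_eq_sum[OF degree_smult_le, of c p A]
  by (simp add: op_poly_def scaleR_sum_right)

lemma op_poly_diff: "op_poly (p - q) A = op_poly p A - op_poly q A"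
  using op_poly_add[of "p - q" q A] by simp

lemma op_poly_mult: "op_poly (p * q) A = op_poly p A o\<^sub>L op_poly q A"
  by (induction p)
    (simp_all add: op_poly_add op_poly_smult op_poly_pCons blinfun_eq_iff blinfun.add_left
      blinfun.scaleR_left)

lemma op_poly_X [simp]: "op_poly [:0, 1:] A = A"
  by (simp add: op_poly_pCons blinfun_eq_iff blinfun.add_left blinfun.scaleR_left)

lemma op_poly_commute: "A (op_poly p A x) = op_poly p A (A x)"
  by (metis op_poly_X op_poly_mult mult.commute blinfun_apply_blinfun_compose)

lemma selfadjoint_op_poly:
  assumes A: "selfadjoint_op A"
  shows "selfadjoint_op (op_poly p A)"
proof (induction p)
  case 0
  show ?case by (simp add: selfadjoint_op_def clinear_op_iff)
next
  case (pCons a p)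
  then have "clinear_op (op_poly (pCons a p) A)"
    using A by (simp add: selfadjoint_op_def clinear_op_iff op_poly_pCons blinfun.add_left
        blinfun.scaleR_left scaleC_add_right scaleR_scaleC scaleC_scaleC mult.commute)
  moreover have "cinner (op_poly (pCons a p) A x) y = cinner x (op_poly (pCons a p) A y)" for x y
  proof -
    have "cinner (A (op_poly p A x)) y = cinner x (A (op_poly p A y))"
      using A pCons.IH by (simp add: selfadjoint_op_def op_poly_commute)
    then show ?thesis
      by (simp add: op_poly_pCons blinfun.add_left blinfun.scaleR_left cinner_add_left cinner_add_right
          cinner_scaleR_left cinner_scaleR_right)
  qed
  ultimately show ?case by (simp add: selfadjoint_op_def)
qed

text \<open>Complex coefficients permit splitting into linear factors. The Horner fold keeps each
  coefficient as a multiple of the identity.\<close>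

definition complex_op_poly ::
    "complex poly \<Rightarrow> ('a::complex_hilbert_space \<Rightarrow>\<^sub>L 'a) \<Rightarrow> ('a \<Rightarrow>\<^sub>L 'a)" where
  "complex_op_poly p A = fold_coeffs (\<lambda>a P. scaleC_op a + (A o\<^sub>L P)) p 0"

lemma complex_op_poly_0 [simp]: "complex_op_poly 0 A = 0"
  by (simp add: complex_op_poly_def)

lemma complex_op_poly_pCons [simp]:
  "complex_op_poly (pCons a p) A x = a *\<^sub>C x + A (complex_op_poly p A x)"
  by (cases "a = 0 \<and> p = 0")
    (auto simp: complex_op_poly_def blinfun.add_left complex_vector.scale_zero_left)

lemma complex_op_poly_add:
  "complex_op_poly (p + q) A x = complex_op_poly p A x + complex_op_poly q A x"
  by (induction p q rule: poly_induct2) (simp_all add: blinfun.add_right scaleC_add_left)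

lemma complex_op_poly_smult:
  assumes "clinear_op A"
  shows "complex_op_poly (smult c p) A x = c *\<^sub>C complex_op_poly p A x"
  by (induction p) (simp_all add: scaleC_add_right scaleC_scaleC clinear_op_scaleC[OF assms])

lemma complex_op_poly_of_real: "complex_op_poly (map_poly of_real p) A = op_poly p A"
  by (induction p)
    (simp_all add: blinfun_eq_iff map_poly_pCons op_poly_pCons blinfun.add_left blinfun.scaleR_left scaleR_scaleC)

text \<open>Induction on the degree splits off a root \<open>z\<close>. It lies outside the
  spectrum, so the factor \<open>A - z\<close> is invertible. In degree 0 the nonempty spectrum
  rules out the zero polynomial.\<close>

lemma boundedly_invertible_complex_op_poly:
  fixes A :: "'a::complex_hilbert_space \<Rightarrow>\<^sub>L 'a"
  assumes A: "clinear_op A" and ne: "op_spectrum A \<noteq> {}"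
    and nz: "\<And>z. z \<in> op_spectrum A \<Longrightarrow> poly p z \<noteq> 0"
  shows "boundedly_invertible (complex_op_poly p A)"
  using nz
proof (induction "degree p" arbitrary: p)
  case 0
  then obtain a where a: "p = [:a:]" by (metis degree_eq_zeroE)
  then have "a \<noteq> 0" using ne 0 by auto
  then show ?case unfolding boundedly_invertible_def a
    by (intro exI[of _ "scaleC_op (inverse a)"])
      (simp add: clinear_op_scaleC_op scaleC_scaleC scaleC_one)
next
  case (Suc n)
  then have "\<not> constant (poly p)" by (simp add: constant_degree)
  then obtain z where "poly p z = 0" using fundamental_theorem_of_algebra by blast
  then obtain r where p: "p = [:- z, 1:] * r" by (auto simp: poly_eq_0_iff_dvd elim: dvdE)
  then have "r \<noteq> 0" using Suc.hyps by auto
  then have deg: "degree r = n" using Suc.hyps(2) unfolding p by (subst (asm) degree_mult_eq) auto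
  have "boundedly_invertible (complex_op_poly r A)"
    using Suc.prems deg by (intro Suc.hyps(1)) (auto simp: p)
  moreover have "boundedly_invertible (blinfun_apply (A - scaleC_op z))"
    using Suc.prems[of z] p in_op_spectrum_iff[of z A] by auto
  ultimately have "boundedly_invertible (\<lambda>x. (A - scaleC_op z) (complex_op_poly r A x))"
    by (simp only: boundedly_invertible_compose)
  moreover have "(A - scaleC_op z) (complex_op_poly r A x) = complex_op_poly p A x" for x
  proof -
    have "p = smult (- z) r + pCons 0 r" by (simp add: p)
    then show ?thesis
      by (simp only: complex_op_poly_add complex_op_poly_smult[OF A])
        (simp add: blinfun.diff_left complex_vector.scale_minus_left)
  qed
  ultimately show ?case by simp
qed

text \<open>This controls operator norms by values on the spectrum, which lets the calculus pass
  from polynomials to uniform limits. The root found for \<open>p - [:s:]\<close> is real because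
  the spectrum of \<open>A\<close> is.\<close>

lemma norm_op_poly_selfadjoint:
  fixes A :: "'a::complex_hilbert_space \<Rightarrow>\<^sub>L 'a"
  assumes A: "selfadjoint_op A" and nz: "(u :: 'a) \<noteq> 0"
  obtains x where "complex_of_real x \<in> op_spectrum A" "norm (op_poly p A) = \<bar>poly p x\<bar>"
proof -
  obtain s where s: "\<bar>s\<bar> = norm (op_poly p A)" "complex_of_real s \<in> op_spectrum (op_poly p A)"
    by (rule selfadjoint_norm_in_op_spectrum[OF selfadjoint_op_poly[OF A] nz])
  define q where "q = p - [:s:]"
  have "complex_op_poly (map_poly of_real q) A = op_poly p A - scaleC_op s"
    unfolding complex_op_poly_of_real q_def op_poly_diff
    by (simp add: blinfun_eq_iff op_poly_pCons blinfun.diff_left blinfun.scaleR_left blinfun.add_left scaleR_scaleC)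
  then have "\<not> boundedly_invertible (complex_op_poly (map_poly of_real q) A)"
    using s(2) in_op_spectrum_iff by metis
  moreover have "op_spectrum A \<noteq> {}"
    using op_spectrum_nonempty[OF selfadjoint_op_clinear[OF A] nz] .
  ultimately obtain z where z: "z \<in> op_spectrum A" "poly (map_poly of_real q) z = 0"
    using boundedly_invertible_complex_op_poly[OF selfadjoint_op_clinear[OF A]] by blast
  define x where "x = Re z"
  have zx: "z = complex_of_real x"
    using op_spectrum_selfadjoint_real[OF A z(1)] by (simp add: x_def complex_eq_iff)
  have "poly (map_poly of_real q) (complex_of_real x) = complex_of_real (poly q x)"
    by (induction q) (simp_all add: map_poly_pCons)
  then have "poly p x = s" using z(2) by (simp add: zx q_def)
  then show ?thesis using that[of x] z(1) s(1) by (simp add: zx)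
qed

section \<open>Continuous functional calculus of positive operators\<close>

text \<open>Stone-Weierstrass, with the approximating polynomial functions turned into elements of
  type \<open>real poly\<close>, as \<open>cont_calculus\<close> requires.\<close>

lemma weierstrass_poly:
  fixes f :: "real \<Rightarrow> real"
  assumes "compact S" "continuous_on S f"
  obtains p :: "nat \<Rightarrow> real poly" where "uniform_limit S (\<lambda>n. poly (p n)) f sequentially"
proof -
  obtain g where g: "uniform_limit S g f sequentially" "\<And>n. polynomial_function (g n)"
    by (rule Stone_Weierstrass_uniform_limit[OF assms]) blast
  have "\<exists>p. g n = poly p" for n
  proof -
    obtain a N where "g n = (\<lambda>x. \<Sum>i\<le>N. a i * x ^ i)"
      using g(2)[of n] unfolding real_polynomial_function_eq[symmetric] real_polynomial_function_iff_sum
      by blast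
    then have "g n = poly (\<Sum>i\<le>N. monom (a i) i)" by (simp add: fun_eq_iff poly_sum poly_monom)
    then show ?thesis by blast
  qed
  then obtain p where "\<And>n. g n = poly (p n)" by metis
  then have "g = (\<lambda>n. poly (p n))" by blast
  then show ?thesis using g(1) that by blast
qed

lemma poly_fun_diff: "poly (p - q :: 'a::comm_ring poly) = (\<lambda>x. poly p x - poly q x)"
  by (simp add: fun_eq_iff)

lemma poly_fun_mult: "poly (p * q :: 'a::comm_semiring_0 poly) = (\<lambda>x. poly p x * poly q x)"
  by (simp add: fun_eq_iff)

definition positive_op :: "('a::complex_hilbert_space \<Rightarrow>\<^sub>L 'a) \<Rightarrow> bool" where
  "positive_op A \<longleftrightarrow> selfadjoint_op A \<and> (\<forall>x. 0 \<le> rinner (A x) x)"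

lemma positive_op_selfadjoint: "positive_op A \<Longrightarrow> selfadjoint_op A"
  by (simp add: positive_op_def)

text \<open>For negative \<open>x\<close>, positivity bounds \<open>A - x\<close> from below by
  \<open>- x\<close>; the upper end is the norm bound on the spectrum. Functions can thus be
  approximated on one explicit interval.\<close>

lemma op_spectrum_positive:
  fixes A :: "'a::complex_hilbert_space \<Rightarrow>\<^sub>L 'a"
  assumes A: "positive_op A" and x: "complex_of_real x \<in> op_spectrum A"
  shows "x \<in> {0..norm A}"
proof -
  have sa: "selfadjoint_op A" and cl: "clinear_op A"
    using A by (simp_all add: positive_op_def selfadjoint_op_clinear)
  have "0 \<le> x"
  proof (rule ccontr)
    assume neg: "\<not> 0 \<le> x"
    have below: "- x * norm v \<le> norm (A v - complex_of_real x *\<^sub>C v)" for v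
    proof (cases "v = 0")
      case False
      have "- x * (norm v)\<^sup>2 \<le> rinner (A v - x *\<^sub>R v) v"
        using A by (simp add: rinner_simps rinner_self positive_op_def)
      also have "\<dots> \<le> norm (A v - x *\<^sub>R v) * norm v" by (rule rinner_le_norm)
      finally have "(- x * norm v) * norm v \<le> norm (A v - x *\<^sub>R v) * norm v"
        by (simp add: power2_eq_square mult.assoc)
      then show ?thesis using False unfolding scaleC_real by (simp only: mult_le_cancel_right) simp
    qed simp
    have "complex_of_real x \<notin> op_spectrum A"
      using below neg
      by (intro not_in_op_spectrumI[OF cl, of "- x"]) (simp_all add: adjoint_op_selfadjoint[OF sa])
    then show False using x by blast
  qed
  then show ?thesis using cmod_le_norm_if_in_op_spectrum[OF cl x] by simp
qed

context
  fixes A :: "'a::complex_hilbert_space \<Rightarrow>\<^sub>L 'a" and u :: 'a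
  assumes A: "positive_op A" and nz: "u \<noteq> 0"
begin

lemma op_poly_tendsto_0:
  assumes "uniform_limit {x. complex_of_real x \<in> op_spectrum A} (\<lambda>n. poly (p n)) (\<lambda>_. 0) F"
  shows "((\<lambda>n. op_poly (p n) A) \<longlongrightarrow> 0) F"
proof (rule tendstoI)
  fix e :: real assume "0 < e"
  from uniform_limitD[OF assms this]
  show "\<forall>\<^sub>F n in F. dist (op_poly (p n) A) 0 < e"
  proof eventually_elim
    case (elim n)
    obtain x where "complex_of_real x \<in> op_spectrum A" "norm (op_poly (p n) A) = \<bar>poly (p n) x\<bar>"
      by (rule norm_op_poly_selfadjoint[OF positive_op_selfadjoint[OF A] nz])
    then show ?case using elim by simp
  qed
qed

text \<open>The definite description in \<open>cont_calculus\<close> is meaningful. Norm attainment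
  on the spectrum makes the operators \<open>op_poly (p n) A\<close> Cauchy and their limit
  independent of the sequence; the given \<open>p\<close> excludes any second candidate.\<close>

lemma op_poly_tendsto_cont_calculus:
  assumes f: "continuous_on {0..norm A} f"
    and p: "uniform_limit {x. complex_of_real x \<in> op_spectrum A} (\<lambda>n. poly (p n)) f sequentially"
  shows "(\<lambda>n. op_poly (p n) A) \<longlonglongrightarrow> cont_calculus f A"
proof -
  define \<sigma> where "\<sigma> = {x. complex_of_real x \<in> op_spectrum A}"
  have \<sigma>: "\<sigma> \<subseteq> {0..norm A}" using op_spectrum_positive[OF A] by (auto simp: \<sigma>_def)
  have p: "uniform_limit \<sigma> (\<lambda>n. poly (p n)) f sequentially" using p by (simp add: \<sigma>_def)
  have "Cauchy (\<lambda>n. op_poly (p n) A)"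
  proof (rule metric_CauchyI)
    fix e :: real assume "0 < e"
    then have "0 < e / 2" by simp
    then obtain N where N: "\<And>n x. n \<ge> N \<Longrightarrow> x \<in> \<sigma> \<Longrightarrow> dist (poly (p n) x) (f x) < e / 2"
      using p unfolding uniform_limit_sequentially_iff by metis
    show "\<exists>M. \<forall>m\<ge>M. \<forall>n\<ge>M. dist (op_poly (p m) A) (op_poly (p n) A) < e"
    proof (intro exI allI impI)
      fix m n assume mn: "m \<ge> N" "n \<ge> N"
      obtain x where x: "complex_of_real x \<in> op_spectrum A"
          "norm (op_poly (p m - p n) A) = \<bar>poly (p m - p n) x\<bar>"
        by (rule norm_op_poly_selfadjoint[OF positive_op_selfadjoint[OF A] nz])
      have "\<bar>poly (p m) x - f x\<bar> < e / 2" "\<bar>poly (p n) x - f x\<bar> < e / 2"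
        using N[OF mn(1), of x] N[OF mn(2), of x] x(1) by (simp_all add: \<sigma>_def dist_real_def)
      then have "norm (op_poly (p m - p n) A) < e" unfolding x(2) poly_diff by linarith
      then show "dist (op_poly (p m) A) (op_poly (p n) A) < e" by (simp add: dist_norm op_poly_diff)
    qed
  qed
  then obtain B where B: "(\<lambda>n. op_poly (p n) A) \<longlonglongrightarrow> B"
    using Cauchy_convergent convergent_def by (metis (no_types))
  have "cont_calculus f A = B"
    unfolding cont_calculus_def \<sigma>_def[symmetric]
  proof (rule the_equality)
    show "\<forall>q. uniform_limit \<sigma> (\<lambda>n. poly (q n)) f sequentially \<longrightarrow> (\<lambda>n. op_poly (q n) A) \<longlonglongrightarrow> B"
    proof (intro allI impI)
      fix q assume q: "uniform_limit \<sigma> (\<lambda>n. poly (q n)) f sequentially"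
      have "uniform_limit \<sigma> (\<lambda>n. poly (q n - p n)) (\<lambda>_. 0) sequentially"
        using uniform_limit_minus[OF q p] by (simp add: poly_fun_diff)
      then have "(\<lambda>n. op_poly (q n - p n) A) \<longlonglongrightarrow> 0"
        unfolding \<sigma>_def by (rule op_poly_tendsto_0)
      from tendsto_add[OF this B] show "(\<lambda>n. op_poly (q n) A) \<longlonglongrightarrow> B"
        by (simp add: op_poly_diff)
    qed
    fix B' assume "\<forall>q. uniform_limit \<sigma> (\<lambda>n. poly (q n)) f sequentially \<longrightarrow> (\<lambda>n. op_poly (q n) A) \<longlonglongrightarrow> B'"
    then show "B' = B" using p B LIMSEQ_unique by blast
  qed
  then show ?thesis using B by simp
qed

text \<open>Approximating on the whole interval lets later arguments bound functions there, without
  further knowledge of the spectrum.\<close>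

lemma cont_calculus_approx:
  assumes "continuous_on {0..norm A} f"
  obtains p where "uniform_limit {0..norm A} (\<lambda>n. poly (p n)) f sequentially"
    "(\<lambda>n. op_poly (p n) A) \<longlonglongrightarrow> cont_calculus f A"
proof -
  obtain p :: "nat \<Rightarrow> real poly" where p: "uniform_limit {0..norm A} (\<lambda>n. poly (p n)) f sequentially"
    by (rule weierstrass_poly[OF compact_Icc assms])
  have "uniform_limit {x. complex_of_real x \<in> op_spectrum A} (\<lambda>n. poly (p n)) f sequentially"
    by (rule uniform_limit_on_subset[OF p]) (use op_spectrum_positive[OF A] in auto)
  then show ?thesis using that p op_poly_tendsto_cont_calculus[OF assms] by blast
qed

lemma cont_calculus_id: "cont_calculus (\<lambda>x. x) A = A"
proof -
  have "uniform_limit {x. complex_of_real x \<in> op_spectrum A} (\<lambda>_. poly [:0, 1:]) (\<lambda>x. x) sequentially"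
    by (rule uniform_limitI) simp
  then have "(\<lambda>_. op_poly [:0, 1:] A) \<longlonglongrightarrow> cont_calculus (\<lambda>x. x) A"
    by (intro op_poly_tendsto_cont_calculus continuous_on_id) 
  then show ?thesis by (simp add: LIMSEQ_const_iff)
qed

lemma cont_calculus_cong:
  assumes "\<And>x. x \<in> {0..norm A} \<Longrightarrow> f x = g x"
  shows "cont_calculus f A = cont_calculus g A"
proof -
  have "uniform_limit {x. complex_of_real x \<in> op_spectrum A} h f sequentially \<longleftrightarrow>
        uniform_limit {x. complex_of_real x \<in> op_spectrum A} h g sequentially" for h
    using op_spectrum_positive[OF A] assms by (intro uniform_limit_cong') auto
  then show ?thesis by (simp add: cont_calculus_def)
qed

lemma cont_calculus_mult:
  assumes f: "continuous_on {0..norm A} f" and g: "continuous_on {0..norm A} g"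
  shows "cont_calculus (\<lambda>x. f x * g x) A = cont_calculus f A o\<^sub>L cont_calculus g A"
proof -
  obtain p where p: "uniform_limit {0..norm A} (\<lambda>n. poly (p n)) f sequentially"
    "(\<lambda>n. op_poly (p n) A) \<longlonglongrightarrow> cont_calculus f A"
    by (rule cont_calculus_approx[OF f])
  obtain q where q: "uniform_limit {0..norm A} (\<lambda>n. poly (q n)) g sequentially"
    "(\<lambda>n. op_poly (q n) A) \<longlonglongrightarrow> cont_calculus g A"
    by (rule cont_calculus_approx[OF g])
  \<comment> \<open>Boundedness of both limits is what makes the products of the approximants
    converge uniformly.\<close>
  have "bounded (f ` {0..norm A})" "bounded (g ` {0..norm A})"
    by (intro compact_imp_bounded compact_continuous_image f g compact_Icc)+
  then have "uniform_limit {0..norm A} (\<lambda>n x. poly (p n) x * poly (q n) x) (\<lambda>x. f x * g x) sequentially"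
    by (intro uniform_lim_mult p q)
  then have "uniform_limit {0..norm A} (\<lambda>n. poly (p n * q n)) (\<lambda>x. f x * g x) sequentially"
    by (simp add: poly_fun_mult)
  then have "uniform_limit {x. complex_of_real x \<in> op_spectrum A} (\<lambda>n. poly (p n * q n)) (\<lambda>x. f x * g x) sequentially"
    by (rule uniform_limit_on_subset) (use op_spectrum_positive[OF A] in auto)
  then have "(\<lambda>n. op_poly (p n * q n) A) \<longlonglongrightarrow> cont_calculus (\<lambda>x. f x * g x) A"
    by (intro op_poly_tendsto_cont_calculus continuous_on_mult f g)
  moreover have "(\<lambda>n. op_poly (p n * q n) A) \<longlonglongrightarrow> (cont_calculus f A o\<^sub>L cont_calculus g A)"
    unfolding op_poly_mult
    by (rule bounded_bilinear.tendsto[OF bounded_bilinear_blinfun_compose p(2) q(2)])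
  ultimately show ?thesis by (rule LIMSEQ_unique)
qed

lemma norm_cont_calculus_le:
  assumes f: "continuous_on {0..norm A} f" and M: "\<And>x. x \<in> {0..norm A} \<Longrightarrow> \<bar>f x\<bar> \<le> M"
  shows "norm (cont_calculus f A) \<le> M"
proof (rule field_le_epsilon)
  fix e :: real assume e: "0 < e"
  obtain p where p: "uniform_limit {0..norm A} (\<lambda>n. poly (p n)) f sequentially"
    "(\<lambda>n. op_poly (p n) A) \<longlonglongrightarrow> cont_calculus f A"
    by (rule cont_calculus_approx[OF f])
  have "\<forall>\<^sub>F n in sequentially. norm (op_poly (p n) A) \<le> M + e"
    using uniform_limitD[OF p(1) e]
  proof eventually_elim
    case (elim n)
    obtain x where x: "complex_of_real x \<in> op_spectrum A" "norm (op_poly (p n) A) = \<bar>poly (p n) x\<bar>"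
      by (rule norm_op_poly_selfadjoint[OF positive_op_selfadjoint[OF A] nz])
    then have "x \<in> {0..norm A}" using op_spectrum_positive[OF A] by blast
    then have "\<bar>poly (p n) x - f x\<bar> < e" "\<bar>f x\<bar> \<le> M"
      using elim M by (auto simp: dist_real_def)
    then show ?case unfolding x(2) by linarith
  qed
  then show "norm (cont_calculus f A) \<le> M + e"
    by (intro tendsto_upperbound[OF tendsto_norm[OF p(2)]]) simp_all
qed

lemma selfadjoint_cont_calculus:
  assumes f: "continuous_on {0..norm A} f"
  shows "selfadjoint_op (cont_calculus f A)"
proof -
  define B where "B = cont_calculus f A"
  obtain p where p: "(\<lambda>n. op_poly (p n) A) \<longlonglongrightarrow> B"
    unfolding B_def by (rule cont_calculus_approx[OF f])
  have sa: "selfadjoint_op (op_poly (p n) A)" for n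
    by (rule selfadjoint_op_poly[OF positive_op_selfadjoint[OF A]])
  have lim: "(\<lambda>n. op_poly (p n) A x) \<longlonglongrightarrow> B x" for x
    by (intro blinfun.tendsto p tendsto_const)
  have scale: "B (a *\<^sub>C x) = a *\<^sub>C B x" for a x
  proof (rule LIMSEQ_unique[OF lim])
    have "(\<lambda>n. scaleC_op a (op_poly (p n) A x)) \<longlonglongrightarrow> scaleC_op a (B x)"
      by (intro blinfun.tendsto lim tendsto_const)
    then show "(\<lambda>n. op_poly (p n) A (a *\<^sub>C x)) \<longlonglongrightarrow> a *\<^sub>C B x"
      by (simp add: clinear_op_scaleC[OF selfadjoint_op_clinear[OF sa]])
  qed
  moreover have "rinner (B x) y = rinner x (B y)" for x y
  proof (rule LIMSEQ_unique)
    show "(\<lambda>n. rinner (op_poly (p n) A x) y) \<longlonglongrightarrow> rinner (B x) y"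
      by (intro tendsto_rinner lim tendsto_const)
    show "(\<lambda>n. rinner (op_poly (p n) A x) y) \<longlonglongrightarrow> rinner x (B y)"
      unfolding selfadjoint_op_rinner[OF sa] by (intro tendsto_rinner lim tendsto_const)
  qed
  ultimately show ?thesis
    unfolding selfadjoint_op_def B_def[symmetric]
    by (simp add: clinear_op_iff cinner_eq_if_rinner_eq[of B B])
qed

text \<open>The operator is the square of the self-adjoint \<open>R\<close> obtained from the root
  of \<open>f\<close>, so its quadratic form is the squared norm of \<open>R x\<close>.\<close>

lemma positive_cont_calculus:
  assumes f: "continuous_on {0..norm A} f" and nonneg: "\<And>x. x \<in> {0..norm A} \<Longrightarrow> 0 \<le> f x"
  shows "positive_op (cont_calculus f A)"
proof -
  define R where "R = cont_calculus (\<lambda>x. sqrt (f x)) A"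
  have c: "continuous_on {0..norm A} (\<lambda>x. sqrt (f x))" by (intro continuous_intros f)
  have "cont_calculus f A = cont_calculus (\<lambda>x. sqrt (f x) * sqrt (f x)) A"
    by (rule cont_calculus_cong) (simp add: nonneg)
  then have "cont_calculus f A = R o\<^sub>L R"
    by (simp only: R_def cont_calculus_mult[OF c c])
  moreover have "selfadjoint_op R" unfolding R_def by (rule selfadjoint_cont_calculus[OF c])
  ultimately have "rinner (cont_calculus f A x) x = (norm (R x))\<^sup>2" for x
    by (simp add: rinner_self[symmetric] selfadjoint_op_rinner[of R "R x"])
  then show ?thesis by (simp add: positive_op_def selfadjoint_cont_calculus[OF f])
qed

end

section \<open>Polar decomposition and the Aluthge transform\<close>

lemma positive_adjoint_op_compose:
  fixes T :: "'a::complex_hilbert_space \<Rightarrow>\<^sub>L 'a"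
  assumes T: "clinear_op T"
  shows "positive_op (adjoint_op T o\<^sub>L T)"
proof -
  have "cinner (adjoint_op T (T x)) y = cinner (T x) (T y)" for x y
    using adjoint_op[OF T, of y "T x"] by (metis cinner_commute)
  then have eq: "cinner ((adjoint_op T o\<^sub>L T) x) y = cinner (T x) (T y)" for x y by simp
  moreover have "cinner (T x) (T y) = cinner x ((adjoint_op T o\<^sub>L T) y)" for x y
    by (simp add: adjoint_op[OF T])
  moreover have "0 \<le> rinner ((adjoint_op T o\<^sub>L T) x) x" for x
    using rinner_self[of "T x"] by (simp add: rinner_def eq del: blinfun_apply_blinfun_compose)
  ultimately show ?thesis
    by (simp add: positive_op_def selfadjoint_op_def clinear_op_compose clinear_op_adjoint T
        del: blinfun_apply_blinfun_compose)
qed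

text \<open>Multiplicativity of the calculus shows that \<open>abs_op T\<close> squares to
  \<open>adjoint_op T o\<^sub>L T\<close>. The equality of norms that results is what the polar
  decomposition is built on.\<close>

lemma abs_op_positive:
  fixes T :: "'a::complex_hilbert_space \<Rightarrow>\<^sub>L 'a"
  assumes T: "clinear_op T" and nz: "(u :: 'a) \<noteq> 0"
  shows "positive_op (abs_op T)" and "norm (abs_op T x) = norm (T x)"
proof -
  define A where "A = adjoint_op T o\<^sub>L T"
  have A: "positive_op A" unfolding A_def by (rule positive_adjoint_op_compose[OF T])
  have c: "continuous_on {0..norm A} sqrt" by (intro continuous_intros)
  have S: "abs_op T = cont_calculus sqrt A" by (simp add: abs_op_def A_def)
  show pos: "positive_op (abs_op T)"
    unfolding S by (rule positive_cont_calculus[OF A nz c]) simp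
  have "abs_op T o\<^sub>L abs_op T = cont_calculus (\<lambda>x. sqrt x * sqrt x) A"
    unfolding S by (rule cont_calculus_mult[OF A nz c c, symmetric])
  also have "\<dots> = cont_calculus (\<lambda>x. x) A" by (rule cont_calculus_cong[OF A nz]) simp
  also have "\<dots> = A" by (rule cont_calculus_id[OF A nz])
  finally have sq: "abs_op T (abs_op T x) = adjoint_op T (T x)"
    unfolding A_def by (metis blinfun_apply_blinfun_compose)
  have "(norm (abs_op T x))\<^sup>2 = rinner x (abs_op T (abs_op T x))"
    by (simp add: rinner_self[symmetric] selfadjoint_op_rinner[OF positive_op_selfadjoint[OF pos]])
  also have "\<dots> = (norm (T x))\<^sup>2"
    by (simp add: sq rinner_self[symmetric] adjoint_op_rinner[OF T])
  finally show "norm (abs_op T x) = norm (T x)" by simp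
qed

section \<open>Existence and uniqueness of the polar factor\<close>

lemma rinner_scaleC_i_swap: "rinner (\<i> *\<^sub>C x) y = - rinner x (\<i> *\<^sub>C y)"
  by (simp add: rinner_def cinner_scaleC_left cinner_scaleC_right)

lemma closure_range_induct:
  assumes "m \<in> closure (range S)" "closed {x. P x}" "\<And>h. P (S h)"
  shows "P m"
  using closure_minimal[of "range S" "{x. P x}"] assms by blast

lemma linear_blinfun: "linear (blinfun_apply T)"
  by (simp add: bounded_linear.linear blinfun.bounded_linear_right)

lemma closed_blinfun_eq: "closed {x. blinfun_apply S x = blinfun_apply T x}"
  by (intro closed_Collect_eq linear_continuous_on blinfun.bounded_linear_right)

context
  fixes T S :: "'a::complex_hilbert_space \<Rightarrow>\<^sub>L 'a"
  assumes T: "clinear_op T" and S: "selfadjoint_op S" and norm_eq: "\<And>x. norm (S x) = norm (T x)"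
begin

lemma ker_eq: "S x = 0 \<longleftrightarrow> T x = 0"
  by (metis norm_eq norm_eq_zero)

lemma closure_range_orthogonal_ker:
  assumes m: "m \<in> closure (range S)" and k: "S k = 0"
  shows "rinner m k = 0"
  using m
proof (rule closure_range_induct)
  show "closed {x. rinner x k = 0}"
    by (intro closed_Collect_eq continuous_intros linear_continuous_on
        bounded_bilinear.bounded_linear_left[OF bounded_bilinear_rinner])
  show "rinner (S h) k = 0" for h by (simp add: selfadjoint_op_rinner[OF S] k)
qed

text \<open>The Riesz argument produces the projection \<open>m\<close> of \<open>x\<close> onto the
  closed range; the rest is orthogonal to the range, hence in the kernel of the self-adjoint
  \<open>S\<close>.\<close>

lemma range_ker_decomposition:
  obtains m k where "x = m + k" "m \<in> closure (range S)" "S k = 0"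
proof -
  have lin: "linear (\<lambda>h. rinner x (S h))"
    by (rule linearI) (simp_all add: blinfun.add_right blinfun.scaleR_right rinner_simps)
  obtain m where m: "m \<in> closure (range S)" "\<And>h. rinner m (S h) = rinner x (S h)"
    by (rule riesz_closure_range[OF linear_blinfun lin abs_rinner_le_norm]) blast
  have "S (x - m) = 0"
    by (rule eq_if_rinner_eq) (simp add: selfadjoint_op_rinner[OF S] rinner_simps m(2))
  then show ?thesis using that[of m "x - m"] m(1) by simp
qed

text \<open>The values on the range of \<open>S\<close> are prescribed by \<open>T\<close> and
  extend to the closure by continuity; on the kernel both factors vanish.\<close>

lemma polar_factor_unique:
  fixes V V' :: "'a \<Rightarrow>\<^sub>L 'a"
  assumes "\<And>x. T x = 0 \<Longrightarrow> V x = 0" "T = V o\<^sub>L S"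
    and "\<And>x. T x = 0 \<Longrightarrow> V' x = 0" "T = V' o\<^sub>L S"
  shows "V = V'"
proof (rule blinfun_eqI)
  fix x
  obtain m k where x: "x = m + k" "m \<in> closure (range S)" "S k = 0"
    by (rule range_ker_decomposition)
  have "V m = V' m"
    using x(2) closed_blinfun_eq
    by (rule closure_range_induct) (metis assms(2,4) blinfun_apply_blinfun_compose)
  moreover have "V k = 0" "V' k = 0" using assms(1,3) ker_eq x(3) by auto
  ultimately show "V x = V' x" by (simp add: x(1) blinfun.add_right)
qed

text \<open>
  The adjoint \<open>W\<close> of the partial isometry is characterised by \<open>\<langle>W y, S h\<rangle> = \<langle>y, T h\<rangle>\<close> and by
  taking values in the closure of the range of \<open>S\<close>.
\<close>

lemma polar_factor_exists:
  obtains V :: "'a \<Rightarrow>\<^sub>L 'a" where "partial_isometry V" "\<And>x. V x = 0 \<longleftrightarrow> T x = 0" "T = V o\<^sub>L S" "norm V \<le> 1"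
proof -
  have "\<exists>m. m \<in> closure (range S) \<and> (\<forall>h. rinner m (S h) = rinner y (T h))" for y
  proof -
    have lin: "linear (\<lambda>h. rinner y (T h))"
      by (rule linearI) (simp_all add: blinfun.add_right blinfun.scaleR_right rinner_simps)
    have bound: "\<bar>rinner y (T h)\<bar> \<le> norm y * norm (S h)" for h
      unfolding norm_eq by (rule abs_rinner_le_norm)
    show ?thesis by (rule riesz_closure_range[OF linear_blinfun lin bound]) blast
  qed
  then obtain w where w_closure: "\<And>y. w y \<in> closure (range S)"
    and w: "\<And>y h. rinner (w y) (S h) = rinner y (T h)" by metis
  have w_ker: "rinner (w y) k = 0" if "S k = 0" for y k
    by (rule closure_range_orthogonal_ker[OF w_closure that])
  \<comment> \<open>Two candidates differ by an element of the kernel of \<open>S\<close> that is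
    also orthogonal to this kernel. Linearity of \<open>w\<close> and its commuting with
    \<open>\<i>\<close> are drawn from this.\<close>
  have w_unique: "w y = m" if m: "\<And>h. rinner m (S h) = rinner y (T h)"
    "\<And>k. S k = 0 \<Longrightarrow> rinner m k = 0" for y m
  proof -
    have "S (w y - m) = 0"
      by (rule eq_if_rinner_eq) (simp add: selfadjoint_op_rinner[OF S] rinner_simps m(1) w)
    then have "(norm (w y - m))\<^sup>2 = 0"
      unfolding rinner_self[symmetric] using m(2) w_ker by (simp add: rinner_simps(3))
    then show ?thesis by simp
  qed
  have w_norm: "norm (w y) \<le> norm y" for y
  proof (cases "w y = 0")
    case False
    have "rinner (w y) (w y) \<le> norm y * norm (w y)"
      using w_closure
    proof (rule closure_range_induct[where P = "\<lambda>x. rinner (w y) x \<le> norm y * norm x"])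
      show "closed {x. rinner (w y) x \<le> norm y * norm x}"
        by (intro closed_Collect_le continuous_intros linear_continuous_on
            bounded_bilinear.bounded_linear_right[OF bounded_bilinear_rinner])
      show "rinner (w y) (S h) \<le> norm y * norm (S h)" for h
        unfolding w norm_eq by (rule rinner_le_norm)
    qed
    then show ?thesis using False by (simp add: rinner_self power2_eq_square)
  qed simp
  have "bounded_linear w"
  proof (rule bounded_linear_intro[where K = 1])
    show "w (x + y) = w x + w y" for x y by (rule w_unique) (simp_all add: rinner_simps w w_ker)
    show "w (r *\<^sub>R x) = r *\<^sub>R w x" for r x by (rule w_unique) (simp_all add: rinner_simps w w_ker)
  qed (simp add: w_norm)
  then obtain W :: "'a \<Rightarrow>\<^sub>L 'a" where W: "\<And>y. W y = w y"
    using bounded_linear_Blinfun_apply by metis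
  have W_lin: "clinear_op W"
  proof (rule clinear_op_if_scaleC_i)
    fix y
    have "w (\<i> *\<^sub>C y) = \<i> *\<^sub>C w y"
    proof (rule w_unique)
      show "rinner (\<i> *\<^sub>C w y) (S h) = rinner (\<i> *\<^sub>C y) (T h)" for h
        using w[of y "\<i> *\<^sub>C h"]
        by (simp add: rinner_scaleC_i_swap clinear_op_scaleC[OF T]
            clinear_op_scaleC[OF selfadjoint_op_clinear[OF S]])
      show "rinner (\<i> *\<^sub>C w y) k = 0" if "S k = 0" for k
        using w_ker[of "\<i> *\<^sub>C k" y] that
        by (simp add: rinner_scaleC_i_swap clinear_op_scaleC[OF selfadjoint_op_clinear[OF S]])
    qed
    then show "W (\<i> *\<^sub>C y) = \<i> *\<^sub>C W y" by (simp add: W)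
  qed
  define V where "V = adjoint_op W"
  have V: "rinner (w y) x = rinner y (V x)" for x y
    using adjoint_op_rinner[OF W_lin] by (simp add: V_def W)
  have V_lin: "clinear_op V" unfolding V_def by (rule clinear_op_adjoint[OF W_lin])
  have VS: "V (S h) = T h" for h
    by (rule eq_if_rinner_eq) (metis V w rinner_commute)
  have V_ker: "V k = 0" if "S k = 0" for k
    by (rule eq_if_rinner_eq) (metis V w_ker[OF that] rinner_commute rinner_zero(1))
  have V_iso: "norm (V m) = norm m" if "m \<in> closure (range S)" for m
    using that
  proof (rule closure_range_induct)
    show "closed {x. norm (V x) = norm x}"
      by (intro closed_Collect_eq continuous_intros linear_continuous_on blinfun.bounded_linear_right)
  qed (simp add: VS norm_eq)
  have "partial_isometry V"
    unfolding partial_isometry_def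
  proof (intro conjI V_lin allI impI)
    fix x assume orth: "\<forall>y. V y = 0 \<longrightarrow> cinner x y = 0"
    obtain m k where x: "x = m + k" "m \<in> closure (range S)" "S k = 0"
      by (rule range_ker_decomposition)
    \<comment> \<open>As \<open>V\<close> vanishes at \<open>k\<close>, the vector \<open>x\<close>
      is orthogonal to its own kernel component. Hence \<open>k = 0\<close>, and \<open>x\<close>
      lies in the closed range, where \<open>V\<close> is isometric.\<close>
    have "rinner x k = 0" using orth V_ker[OF x(3)] by (simp add: rinner_def)
    then have "(norm k)\<^sup>2 = 0"
      unfolding rinner_self[symmetric]
      using closure_range_orthogonal_ker[OF x(2,3)] by (simp add: x(1) rinner_simps)
    then show "norm (V x) = norm x" using V_iso[OF x(2)] by (simp add: x(1))
  qed
  moreover have "V x = 0 \<longleftrightarrow> T x = 0" for x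
  proof
    assume "V x = 0"
    obtain m k where x: "x = m + k" "m \<in> closure (range S)" "S k = 0"
      by (rule range_ker_decomposition)
    have "V m = 0" using \<open>V x = 0\<close> V_ker[OF x(3)] by (simp add: x(1) blinfun.add_right)
    then have "m = 0" using V_iso[OF x(2)] by simp
    then show "T x = 0" using x by (simp add: ker_eq)
  qed (simp add: V_ker ker_eq)
  moreover have "T = V o\<^sub>L S" by (simp add: blinfun_eq_iff VS)
  moreover have "norm V \<le> 1"
  proof (rule norm_blinfun_bound)
    fix x
    have "norm (V x) \<le> norm W * norm x" unfolding V_def by (rule norm_adjoint_op_le[OF W_lin])
    also have "\<dots> \<le> 1 * norm x"
      by (intro mult_right_mono norm_blinfun_bound) (simp_all add: W w_norm)
    finally show "norm (V x) \<le> 1 * norm x" .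
  qed simp
  ultimately show ?thesis by (rule that)
qed

end

text \<open>Existence and uniqueness of the factor, taken with \<open>abs_op T\<close> for
  \<open>S\<close>, make the definite description in \<open>polar_part\<close> meaningful.\<close>

lemma polar_part:
  fixes T :: "'a::complex_hilbert_space \<Rightarrow>\<^sub>L 'a"
  assumes T: "clinear_op T" and nz: "(u :: 'a) \<noteq> 0"
  shows "clinear_op (polar_part T)" "T = polar_part T o\<^sub>L abs_op T" "norm (polar_part T) \<le> 1"
proof -
  have S: "selfadjoint_op (abs_op T)" by (rule positive_op_selfadjoint[OF abs_op_positive(1)[OF T nz]])
  note facts = T S abs_op_positive(2)[OF T nz]
  obtain V :: "'a \<Rightarrow>\<^sub>L 'a" where V: "partial_isometry V" "\<And>x. V x = 0 \<longleftrightarrow> T x = 0" "T = V o\<^sub>L abs_op T" "norm V \<le> 1"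
    by (rule polar_factor_exists[OF facts]) blast
  have polar_eq: "polar_part T = V"
    unfolding polar_part_def
  proof (rule the_equality)
    fix V' :: "'a \<Rightarrow>\<^sub>L 'a"
    assume V': "partial_isometry V' \<and> (\<forall>x. V' x = 0 \<longleftrightarrow> T x = 0) \<and> T = V' o\<^sub>L abs_op T"
    show "V' = V"
    proof (rule polar_factor_unique[OF facts])
      show "V' x = 0" if "T x = 0" for x using conjunct1[OF conjunct2[OF V']] that by blast
      show "T = V' o\<^sub>L abs_op T" by (rule conjunct2[OF conjunct2[OF V']])
      show "V x = 0" if "T x = 0" for x using V(2) that by blast
      show "T = V o\<^sub>L abs_op T" by (rule V(3))
    qed
  next
    show "partial_isometry V \<and> (\<forall>x. V x = 0 \<longleftrightarrow> T x = 0) \<and> T = V o\<^sub>L abs_op T"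
      by (intro conjI allI V)
  qed
  show "T = polar_part T o\<^sub>L abs_op T" unfolding polar_eq by (rule V(3))
  show "clinear_op (polar_part T)" "norm (polar_part T) \<le> 1"
    using V(1,4) unfolding polar_eq partial_isometry_def by blast+
qed

text \<open>Each claim transfers a property of the real power function on
  \<open>{0..norm S}\<close>. Positive exponents make that function continuous at 0; exponent 0 is
  the identity by definition.\<close>

lemma op_powr:
  fixes S :: "'a::complex_hilbert_space \<Rightarrow>\<^sub>L 'a"
  assumes S: "positive_op S" and nz: "(u :: 'a) \<noteq> 0"
  shows op_powr_clinear: "0 \<le> t \<Longrightarrow> clinear_op (op_powr S t)"
    and op_powr_norm: "0 < t \<Longrightarrow> norm (op_powr S t) \<le> norm S powr t"
    and op_powr_one: "op_powr S 1 = S"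
    and op_powr_add: "0 < s \<Longrightarrow> 0 < t \<Longrightarrow> op_powr S (s + t) = op_powr S s o\<^sub>L op_powr S t"
proof -
  have c: "continuous_on {0..norm S} (\<lambda>x. x powr t)" if "0 < t" for t
    using that by (intro continuous_on_powr' continuous_intros) auto
  show "clinear_op (op_powr S t)" if "0 \<le> t"
    using that selfadjoint_cont_calculus[OF S nz c, of t]
    by (auto simp: op_powr_def clinear_op_id selfadjoint_op_clinear)
  show "norm (op_powr S t) \<le> norm S powr t" if "0 < t"
    using that norm_cont_calculus_le[OF S nz c, of t] by (simp add: op_powr_def powr_mono2)
  have "cont_calculus (\<lambda>x. x powr 1) S = cont_calculus (\<lambda>x. x) S"
    by (rule cont_calculus_cong[OF S nz]) simp
  then show "op_powr S 1 = S" by (simp add: op_powr_def cont_calculus_id[OF S nz])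
  show "op_powr S (s + t) = op_powr S s o\<^sub>L op_powr S t" if "0 < s" "0 < t"
    using that cont_calculus_mult[OF S nz c c, of s t] by (simp add: op_powr_def powr_add)
qed

text \<open>For \<open>t\<close> strictly between 0 and 1 both claims follow from adding exponents.
  At the endpoints one factor is the identity, of norm at most 1, which also gives the norm
  bound.\<close>

lemma op_powr_complementary:
  fixes S :: "'a::complex_hilbert_space \<Rightarrow>\<^sub>L 'a"
  assumes S: "positive_op S" and nz: "(u :: 'a) \<noteq> 0" and t: "0 \<le> t" "t \<le> 1"
  shows "op_powr S (1 - t) o\<^sub>L op_powr S t = S"
    and "norm (op_powr S t) * norm (op_powr S (1 - t)) \<le> norm S"
proof -
  have zero: "op_powr S 0 = id_blinfun" by (simp add: op_powr_def)
  have id_le: "norm (id_blinfun :: 'a \<Rightarrow>\<^sub>L 'a) \<le> 1" by (rule norm_blinfun_bound) simp_all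
  consider "t = 0" | "t = 1" | "0 < t" "t < 1" using t by linarith
  then have "op_powr S (1 - t) o\<^sub>L op_powr S t = S \<and>
      norm (op_powr S t) * norm (op_powr S (1 - t)) \<le> norm S"
  proof cases
    case 1
    then show ?thesis using mult_right_mono[OF id_le norm_ge_zero[of S]]
      by (simp add: zero op_powr_one[OF S nz] blinfun_eq_iff)
  next
    case 2
    then show ?thesis using mult_left_mono[OF id_le norm_ge_zero[of S]]
      by (simp add: zero op_powr_one[OF S nz] blinfun_eq_iff)
  next
    case 3
    have "norm (op_powr S t) * norm (op_powr S (1 - t)) \<le> norm S powr t * norm S powr (1 - t)"
      using 3 by (intro mult_mono op_powr_norm[OF S nz]) auto
    also have "\<dots> = norm S" by (simp add: powr_add[symmetric])
    finally show ?thesis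
      using op_powr_add[OF S nz, of "1 - t" t] 3 by (simp add: op_powr_one[OF S nz])
  qed
  then show "op_powr S (1 - t) o\<^sub>L op_powr S t = S"
    and "norm (op_powr S t) * norm (op_powr S (1 - t)) \<le> norm S" by blast+
qed

text \<open>
  An inverse \<open>R\<close> of \<open>Y X - z\<close> yields the inverse \<open>(X R Y - 1) / z\<close> of \<open>X Y - z\<close>.
\<close>

lemma op_spectrum_compose_commute:
  fixes X Y :: "'a::complex_hilbert_space \<Rightarrow>\<^sub>L 'a"
  assumes X: "clinear_op X" and Y: "clinear_op Y" and z: "z \<noteq> 0"
    and spec: "z \<in> op_spectrum (X o\<^sub>L Y)"
  shows "z \<in> op_spectrum (Y o\<^sub>L X)"
proof (rule ccontr)
  assume "z \<notin> op_spectrum (Y o\<^sub>L X)"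
  then obtain R :: "'a \<Rightarrow>\<^sub>L 'a" where R: "clinear_op R"
    "\<And>x. R (Y (X x) - z *\<^sub>C x) = x" "\<And>x. Y (X (R x)) - z *\<^sub>C R x = x"
    unfolding op_spectrum_def by auto
  define Q where "Q = scaleC_op (inverse z) o\<^sub>L ((X o\<^sub>L R o\<^sub>L Y) - id_blinfun)"
  have Q: "Q x = inverse z *\<^sub>C (X (R (Y x)) - x)" for x by (simp add: Q_def blinfun.diff_left)
  have "clinear_op Q"
    unfolding Q_def
    by (intro clinear_op_compose clinear_op_diff clinear_op_scaleC_op clinear_op_id X Y R)
  moreover have "Q (X (Y x) - z *\<^sub>C x) = x" for x
  proof -
    have "R (Y (X (Y x))) - z *\<^sub>C R (Y x) = Y x"
      using R(2)[of "Y x"] by (simp add: blinfun.diff_right clinear_op_scaleC[OF R(1)])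
    then have "X (R (Y (X (Y x)))) - z *\<^sub>C X (R (Y x)) = X (Y x)"
      by (metis blinfun.diff_right clinear_op_scaleC[OF X])
    then have "X (R (Y (X (Y x) - z *\<^sub>C x))) - (X (Y x) - z *\<^sub>C x) = z *\<^sub>C x"
      by (simp add: blinfun.diff_right clinear_op_scaleC X Y R(1) algebra_simps)
    then show ?thesis using z by (simp add: Q scaleC_scaleC scaleC_one)
  qed
  moreover have "X (Y (Q x)) - z *\<^sub>C Q x = x" for x
  proof -
    have "X (Y (X (R (Y x)))) - z *\<^sub>C X (R (Y x)) = X (Y x)"
      using R(3)[of "Y x"] by (metis blinfun.diff_right clinear_op_scaleC[OF X])
    then have "X (Y (X (R (Y x)) - x)) - z *\<^sub>C (X (R (Y x)) - x) = z *\<^sub>C x"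
      by (simp add: blinfun.diff_right complex_vector.scale_right_diff_distrib algebra_simps)
    moreover have "X (Y (Q x)) - z *\<^sub>C Q x
        = inverse z *\<^sub>C (X (Y (X (R (Y x)) - x)) - z *\<^sub>C (X (R (Y x)) - x))"
      by (simp add: Q clinear_op_scaleC X Y blinfun.diff_right complex_vector.scale_right_diff_distrib scaleC_scaleC mult.commute)
    ultimately show ?thesis using z by (simp add: scaleC_scaleC scaleC_one)
  qed
  ultimately have "z \<notin> op_spectrum (X o\<^sub>L Y)" unfolding op_spectrum_def by auto
  then show False using spec by blast
qed

lemma aluthge:
  fixes T :: "'a::complex_hilbert_space \<Rightarrow>\<^sub>L 'a"
  assumes T: "clinear_op T" and nz: "(u :: 'a) \<noteq> 0" and t: "0 \<le> t" "t \<le> 1"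
  shows clinear_op_aluthge: "clinear_op (aluthge t T)"
    and norm_aluthge_le: "norm (aluthge t T) \<le> norm T"
    and op_spectrum_aluthge: "z \<noteq> 0 \<Longrightarrow> z \<in> op_spectrum T \<Longrightarrow> z \<in> op_spectrum (aluthge t T)"
proof -
  define S V where "S = abs_op T" and "V = polar_part T"
  define P Q where "P = op_powr S t" and "Q = op_powr S (1 - t)"
  have S: "positive_op S" "\<And>x. norm (S x) = norm (T x)"
    unfolding S_def by (rule abs_op_positive[OF T nz])+
  have V: "clinear_op V" "T = V o\<^sub>L S" "norm V \<le> 1"
    unfolding V_def S_def by (rule polar_part[OF T nz])+
  have P: "clinear_op P" and Q: "clinear_op Q" and QP: "Q o\<^sub>L P = S" and le: "norm P * norm Q \<le> norm S"
    unfolding P_def Q_def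
    using op_powr_clinear[OF S(1) nz] op_powr_complementary[OF S(1) nz t] t by auto
  have alu: "aluthge t T = P o\<^sub>L (V o\<^sub>L Q)"
    by (simp add: aluthge_def P_def Q_def V_def S_def blinfun_eq_iff)
  \<comment> \<open>Splitting the modulus as \<open>Q o\<^sub>L P\<close> exhibits \<open>T\<close>
    and its transform as the two products of the same pair of factors.\<close>
  have fac: "T = (V o\<^sub>L Q) o\<^sub>L P"
    by (subst V(2), subst QP[symmetric]) (simp add: blinfun_eq_iff)
  have "norm S \<le> norm T" by (rule norm_blinfun_bound) (simp_all add: S(2) norm_blinfun)
  have "norm (aluthge t T) \<le> norm P * (norm V * norm Q)"
    unfolding alu by (intro order.trans[OF norm_blinfun_compose] mult_left_mono norm_blinfun_compose norm_ge_zero)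
  also have "\<dots> \<le> norm P * (1 * norm Q)"
    by (intro mult_left_mono mult_right_mono V norm_ge_zero)
  also have "\<dots> \<le> norm T" using le \<open>norm S \<le> norm T\<close> by simp
  finally show "norm (aluthge t T) \<le> norm T" .
  show "clinear_op (aluthge t T)" unfolding alu by (intro clinear_op_compose P Q V)
  show "z \<in> op_spectrum (aluthge t T)" if "z \<noteq> 0" "z \<in> op_spectrum T"
    unfolding alu using that op_spectrum_compose_commute[of "V o\<^sub>L Q" P z]
    by (simp add: fac[symmetric] clinear_op_compose P Q V(1))
qed

section \<open>Convergence of the norms of the iterated transforms\<close>

theorem theorem1p5:
  fixes T :: "'a::complex_hilbert_space \<Rightarrow>\<^sub>L 'a" and t :: real
  assumes "\<not> (\<exists>B :: 'a set. finite B \<and> complex_vector.span B = UNIV)"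
    and "clinear_op T"
    and "0 \<le> t" and "t \<le> 1"
  shows "\<exists>s :: real. 0 \<le> s \<and> op_spectral_radius T \<le> s \<and> s \<le> norm T \<and>
    (\<lambda>n. norm ((aluthge t ^^ n) T)) \<longlonglongrightarrow> s"
proof -
  \<comment> \<open>In the zero space the empty set would be a finite spanning set.\<close>
  have "\<exists>u :: 'a. u \<noteq> 0"
  proof (rule ccontr)
    assume "\<nexists>u :: 'a. u \<noteq> 0"
    then have "complex_vector.span {} = (UNIV :: 'a set)" by auto
    then show False using assms(1) by blast
  qed
  then obtain u :: 'a where u: "u \<noteq> 0" ..
  define D where "D n = (aluthge t ^^ n) T" for n
  have D_Suc: "D (Suc n) = aluthge t (D n)" for n by (simp add: D_def)
  have D_lin: "clinear_op (D n)" for n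
    by (induction n) (use assms in \<open>simp_all add: D_Suc clinear_op_aluthge[OF _ u]\<close>, simp add: D_def)
  have "decseq (\<lambda>n. norm (D n))"
    by (rule decseq_SucI) (simp add: D_Suc norm_aluthge_le[OF D_lin u assms(3,4)])
  then obtain s where s: "(\<lambda>n. norm (D n)) \<longlonglongrightarrow> s" and s_le: "\<And>n. s \<le> norm (D n)"
    by (rule decseq_convergent[where B = 0]) auto
  have s0: "0 \<le> s" by (rule LIMSEQ_le_const[OF s]) simp
  \<comment> \<open>A nonzero \<open>z\<close> stays in the spectrum of every iterate, so all the
    norms dominate \<open>cmod z\<close>, and so does their limit; for \<open>z = 0\<close> the
    bound is \<open>s0\<close>.\<close>
  have "cmod z \<le> s" if z: "z \<in> op_spectrum T" for z
  proof (cases "z = 0")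
    case False
    have "z \<in> op_spectrum (D n)" for n
    proof (induction n)
      case 0
      then show ?case using z by (simp add: D_def)
    next
      case (Suc n)
      then show ?case unfolding D_Suc by (rule op_spectrum_aluthge[OF D_lin u assms(3,4) False])
    qed
    then have "cmod z \<le> norm (D n)" for n by (rule cmod_le_norm_if_in_op_spectrum[OF D_lin])
    then show ?thesis by (intro LIMSEQ_le_const[OF s]) blast
  qed (use s0 in simp)
  \<comment> \<open>The supremum over the spectrum inherits the pointwise bound because the spectrum
    is nonempty.\<close>
  then have "op_spectral_radius T \<le> s"
    unfolding op_spectral_radius_def
    by (intro cSUP_least op_spectrum_nonempty[OF assms(2) u])
  moreover have "s \<le> norm T" using s_le[of 0] by (simp add: D_def)
  ultimately show ?thesis using s s0 unfolding D_def by blast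
qed

end
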